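(* Let $(u_h,p_h)$ be the solution of the discrete problem (D) described in the context, and let $\pi_h^0$ be the stabilised $L^2$-projection defined there. If $\Gamma_p\neq\emptyset$, then $\mathrm{div}\,u_h=-\pi_h^0(g)$ on $\Omega_h$. If $\Gamma_p=\emptyset$, then there exists a constant $c_h\in\mathbb{R}$ such that $\mathrm{div}\,u_h=-\pi_h^0(g)+c_h$ on $\Omega_h$. For $g=0$, $\mathrm{div}\,u_h$ is zero if $\Gamma_p\neq\emptyset$ and constant otherwise.
   Context: Geometry. $\Omega\subset\mathbb{R}^d$ is homeomorphic to an open polyhedral domain, with boundary $\Gamma=\partial\Omega$ partitioned into $\Gamma_u$ and $\Gamma_p$ and outward unit normal $n$. It is embedded in a background domain carrying a conforming, quasi-uniform, shape-regular mesh $\mathcal{T}_h^{\mathrm{bg}}$ of characteristic size $h$. $\mathcal{T}_h$ is the set of cells of $\mathcal{T}_h^{\mathrm{bg}}$ that intersect $\Omega$ (active cells), and the active domain $\Omega_h$ is the interior of the closure of $\bigcup_{T\in\mathcal{T}_h}T$. $\Omega^{\mathrm{ext}}$ is a fixed smooth domain with $\Omega_h\subset\Omega^{\mathrm{ext}}$ for all $0<h\le h_0$. $(\cdot,\cdot)_\omega$ is the $L^2(\omega)$ inner product. The notation $a\lesssim b$ means $a\le Cb$ with $C>0$ independent of $h$ and of the cut location (how $\Gamma$ intersects the mesh); $a\simeq b$ means $a\lesssim b$ and $b\lesssim a$. Discrete spaces. $V_{\mathrm{d},h}=\{v_h\in H(\mathrm{div},\Omega_h): v_h|_T\in\mathcal{V}_{\mathrm{d}}(T)\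 \forall T\in\mathcal{T}_h\}$, where $\mathcal{V}_{\mathrm{d}}$ is a space of vector fields with polynomial components and $\mathcal{V}_{\mathrm{d}}(T)$ its restriction to $T$; $V_{0,h}\subset L^2(\Omega_h)$ is the space of discontinuous piecewise polynomials with restriction to each $T\in\mathcal{T}_h$ in $\mathcal{V}_0(T)$. They determine a discrete de Rham complex between $(d-1)$- and $d$-forms with bounded cochain interpolators $\Pi_{\mathrm{d},h}$ and $\Pi_{0,h}$ onto $V_{\mathrm{d},h}$ and $V_{0,h}$ (acting as the identity on the discrete spaces, and $\mathrm{div}\,\Pi_{\mathrm{d},h}=\Pi_{0,h}\,\mathrm{div}$), and $\mathrm{div}\,V_{\mathrm{d},h}=V_{0,h}$. $k_u,k_p\ge 0$ are the largest integers with $[\mathbb{P}_{k_u}(T)]^d\subset\mathcal{V}_{\mathrm{d}}(T)$ and $\mathbb{P}_{k_p}(T)\subset\mathcal{V}_0(T)$ for all $T\in\mathcal{T}_h$, where $\mathbb{P}_k$ denotes polynomials of degree at most $k$. Moreover $\|u-\Pi_{\mathrm{d},h}u\|_{L^2(\Omega_h)}\lesssim h^r\|u\|_{H^r(\Omega_h)}$ for $r=0,\dots,k_u+1$ and $\|p-\Pi_{0,h}p\|_{L^2(\Omega_h)}\lesssim h^t\|p\|_{H^t(\Omega_h)}$ for $t=0,\dots,k_p+1$. Stabilisation. $s_h^{\mathrm{d}}$ and $s_h^0$ are bilinear forms on $V_{\mathrm{d},h}$ and $V_{0,h}$, respectively, such that $\|w_h\|^2_{L^2(\Omega)}+s_h^{\mathrm{d}}(w_h,w_h)\simeq\|w_h\|^2_{L^2(\Omega_h)}$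 for all $w_h\in V_{\mathrm{d},h}$; $\|r_h\|^2_{L^2(\Omega)}+s_h^0(r_h,r_h)\simeq\|r_h\|^2_{L^2(\Omega_h)}$ for all $r_h\in V_{0,h}$; $s_h^{\mathrm{d}}(\Pi_{\mathrm{d},h}w,v_h)\lesssim h^s\|w\|_{H^s(\Omega^{\mathrm{ext}})}\|v_h\|_{L^2(\Omega_h)}$ for $0\le s\le k_u+1$, $w\in[H^s(\Omega^{\mathrm{ext}})]^d$, $v_h\in V_{\mathrm{d},h}$; $s_h^0(\Pi_{0,h}r,q_h)\lesssim h^t\|r\|_{H^t(\Omega^{\mathrm{ext}})}\|q_h\|_{L^2(\Omega_h)}$ for $0\le t\le k_p+1$, $r\in H^t(\Omega^{\mathrm{ext}})$, $q_h\in V_{0,h}$; and $s_h^0(c,q_h)=0$ for every constant $c$ and every $q_h\in V_{0,h}$. Discrete problem (D). Let $\gamma,\tau_{\mathrm{d}},\tau_0>0$ be numerical parameters and let data $f\in[L^2(\Omega)]^d$, $g\in L^2(\Omega)$, $u_\Gamma$ (normal flux on $\Gamma_u$), $p_\Gamma$ (pressure on $\Gamma_p$) be given. Put $a_h(u_h,v_h)=(u_h,v_h)_\Omega+\gamma h^{-1}(u_h\cdot n,v_h\cdot n)_{\Gamma_u}+\tau_{\mathrm{d}}s_h^{\mathrm{d}}(u_h,v_h)$, $b_h(v_h,p_h)=-(\mathrm{div}\,v_h,p_h)_\Omega-\tau_0 s_h^0(\mathrm{div}\,v_h,p_h)$, $\tilde b_h(v_h,p_h)=b_h(v_h,p_h)+(v_h\cdot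 n,p_h)_{\Gamma_u}$. Find $(u_h,p_h)\in V_{\mathrm{d},h}\times V_{0,h}$ such that for all $(v_h,q_h)\in V_{\mathrm{d},h}\times V_{0,h}$, $a_h(u_h,v_h)+\tilde b_h(v_h,p_h)=(f,v_h)_\Omega+\gamma h^{-1}(u_\Gamma,v_h\cdot n)_{\Gamma_u}-(v_h\cdot n,p_\Gamma)_{\Gamma_p}$ and $b_h(u_h,q_h)=(g,q_h)_\Omega$. If $\Gamma_p=\emptyset$, the pressure trial and test spaces are both replaced by $V_{0,h}\cap L^2_0(\Omega)$ (functions of $V_{0,h}$ with zero mean over $\Omega$). Stabilised projection. For $r\in L^2(\Omega)$, $\pi_h^0(r)\in V_{0,h}$ is defined by $(\pi_h^0(r),q_h)_\Omega+\tau_0 s_h^0(\pi_h^0(r),q_h)=(r,q_h)_\Omega$ for all $q_h\in V_{0,h}$. *)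

theory Defs
  imports "HOL-Analysis.Analysis"
begin

section \<open>L2 spaces, polynomials, weak derivatives\<close>

text \<open>Elements of Lebesgue and Sobolev spaces are represented by functions; equality in these
  spaces is equality almost everywhere.\<close>

definition L2_space :: "'b measure \<Rightarrow> ('b \<Rightarrow> 'c::euclidean_space) set" where
  "L2_space M = {f \<in> borel_measurable M. integrable M (\<lambda>x. (norm (f x))\<^sup>2)}"

definition L2_inner :: "'b measure \<Rightarrow> ('b \<Rightarrow> 'c::euclidean_space) \<Rightarrow> ('b \<Rightarrow> 'c) \<Rightarrow> real" where
  "L2_inner M f g = (\<integral>x. f x \<bullet> g x \<partial>M)"

definition L2_norm :: "'b measure \<Rightarrow> ('b \<Rightarrow> 'c::euclidean_space) \<Rightarrow> real" where
  "L2_norm M f = sqrt (L2_inner M f f)"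

definition linear_space :: "('b \<Rightarrow> 'c::real_vector) set \<Rightarrow> bool" where
  "linear_space V \<longleftrightarrow> (\<lambda>x. 0) \<in> V \<and>
     (\<forall>u\<in>V. \<forall>v\<in>V. \<forall>c::real. (\<lambda>x. u x + c *\<^sub>R v x) \<in> V)"

text \<open>Polynomials of total degree at most \<open>k\<close>, with coefficients in \<open>'b\<close>; for \<open>'b = 'a\<close> this
  is the space of vector fields all of whose components are polynomials of degree at most \<open>k\<close>.\<close>

definition polys :: "nat \<Rightarrow> ('a::euclidean_space \<Rightarrow> 'b::euclidean_space) set" where
  "polys k = {p. \<exists>c :: ('a \<Rightarrow> nat) \<Rightarrow> 'b.
     p = (\<lambda>x. \<Sum>\<alpha> \<in> {\<alpha> \<in> Basis \<rightarrow>\<^sub>E {..k}. sum \<alpha> Basis \<le> k}.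
                (\<Prod>b\<in>Basis. (x \<bullet> b) ^ \<alpha> b) *\<^sub>R c \<alpha>)}"

text \<open>Iterated classical directional derivative along a list of directions.\<close>

fun iter_deriv :: "'a::euclidean_space list \<Rightarrow> ('a \<Rightarrow> real) \<Rightarrow> 'a \<Rightarrow> real" where
  "iter_deriv [] f = f"
| "iter_deriv (b # bs) f = (\<lambda>x. frechet_derivative (iter_deriv bs f) (at x) b)"

definition smooth_fun :: "('a::euclidean_space \<Rightarrow> real) \<Rightarrow> bool" where
  "smooth_fun f \<longleftrightarrow> (\<forall>bs. set bs \<subseteq> Basis \<longrightarrow> (\<forall>x. iter_deriv bs f differentiable (at x)))"

definition test_functions :: "'a::euclidean_space set \<Rightarrow> ('a \<Rightarrow> real) set" where
  "test_functions \<omega> = {\<phi>. smooth_fun \<phi> \<and> compact (closure {x. \<phi> x \<noteq> 0}) \<and>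
                             closure {x. \<phi> x \<noteq> 0} \<subseteq> \<omega>}"

definition has_weak_deriv ::
  "'a::euclidean_space set \<Rightarrow> 'a list \<Rightarrow> ('a \<Rightarrow> 'b::euclidean_space) \<Rightarrow> ('a \<Rightarrow> 'b) \<Rightarrow> bool" where
  "has_weak_deriv \<omega> bs u w \<longleftrightarrow> w \<in> L2_space (lebesgue_on \<omega>) \<and>
     (\<forall>\<phi> \<in> test_functions \<omega>.
        (\<integral>x. iter_deriv bs \<phi> x *\<^sub>R u x \<partial>lebesgue_on \<omega>) =
        (-1) ^ length bs *\<^sub>R (\<integral>x. \<phi> x *\<^sub>R w x \<partial>lebesgue_on \<omega>))"

definition Sobolev :: "nat \<Rightarrow> 'a::euclidean_space set \<Rightarrow> ('a \<Rightarrow> 'b::euclidean_space) set" where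
  "Sobolev r \<omega> = {u \<in> L2_space (lebesgue_on \<omega>).
     \<forall>bs. set bs \<subseteq> Basis \<and> length bs \<le> r \<longrightarrow> (\<exists>w. has_weak_deriv \<omega> bs u w)}"

text \<open>The square of the norm is the sum over \<open>j \<le> r\<close> of the squared L2 norms of the full
  derivative tensors of order \<open>j\<close> (Frobenius norm), whose entries are indexed by the lists of
  \<open>j\<close> coordinate directions.\<close>

definition Sobolev_norm :: "nat \<Rightarrow> 'a::euclidean_space set \<Rightarrow> ('a \<Rightarrow> 'b::euclidean_space) \<Rightarrow> real" where
  "Sobolev_norm r \<omega> u =
     sqrt (\<Sum>bs | set bs \<subseteq> Basis \<and> length bs \<le> r.
             (L2_norm (lebesgue_on \<omega>) (SOME w. has_weak_deriv \<omega> bs u w))\<^sup>2)"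

text \<open>In the next definition \<open>frechet_derivative \<phi> (at x) (v x)\<close> is the inner product of the gradient
  of \<open>\<phi>\<close> with \<open>v\<close>.\<close>

definition has_weak_div :: "'a::euclidean_space set \<Rightarrow> ('a \<Rightarrow> 'a) \<Rightarrow> ('a \<Rightarrow> real) \<Rightarrow> bool" where
  "has_weak_div \<omega> v q \<longleftrightarrow> q \<in> L2_space (lebesgue_on \<omega>) \<and>
     (\<forall>\<phi> \<in> test_functions \<omega>.
        (\<integral>x. frechet_derivative \<phi> (at x) (v x) \<partial>lebesgue_on \<omega>) =
        - (\<integral>x. q x * \<phi> x \<partial>lebesgue_on \<omega>))"

definition Hdiv :: "'a::euclidean_space set \<Rightarrow> ('a \<Rightarrow> 'a) set" where
  "Hdiv \<omega> = {v \<in> L2_space (lebesgue_on \<omega>). \<exists>q. has_weak_div \<omega> v q}"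

definition weak_div :: "'a::euclidean_space set \<Rightarrow> ('a \<Rightarrow> 'a) \<Rightarrow> 'a \<Rightarrow> real" where
  "weak_div \<omega> v = (SOME q. has_weak_div \<omega> v q)"


section \<open>Geometry\<close>

text \<open>Hausdorff measure, normalised to agree with \<open>s\<close>-dimensional volume. The empty set is
  treated separately because \<open>0 ^ 0 = 1\<close>.\<close>

definition hausdorff_outer :: "nat \<Rightarrow> 'a::metric_space set \<Rightarrow> ennreal" where
  "hausdorff_outer s A =
     (SUP \<delta> \<in> {0<..}.
        INF U \<in> {U :: nat \<Rightarrow> 'a set. A \<subseteq> \<Union>(range U) \<and>
                    (\<forall>i. bounded (U i) \<and> diameter (U i) \<le> \<delta>)}.
          (\<Sum>i. if U i = {} then 0
                else ennreal (unit_ball_vol (real s) * (diameter (U i) / 2) ^ s)))"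

definition surface_measure :: "'a::euclidean_space measure" where
  "surface_measure = measure_of UNIV (sets borel) (hausdorff_outer (DIM('a) - 1))"

abbreviation surface_on :: "'a::euclidean_space set \<Rightarrow> 'a measure" where
  "surface_on \<Sigma> \<equiv> restrict_space surface_measure \<Sigma>"

definition open_polyhedral_domain :: "'a::euclidean_space set \<Rightarrow> bool" where
  "open_polyhedral_domain P \<longleftrightarrow> open P \<and> connected P \<and> bounded P \<and> P \<noteq> {} \<and>
     (\<exists>F. finite F \<and> (\<forall>K\<in>F. polytope K \<and> aff_dim K = int (DIM('a)) - 1) \<and> frontier P = \<Union>F)"

text \<open>The unit vector \<open>\<nu>\<close> is the outward normal at \<open>x\<close> if, near \<open>x\<close>, \<open>\<omega>\<close> contains every cone
  about \<open>-\<nu>\<close>, and its complement every cone about \<open>\<nu>\<close>, of opening less than a half-space.\<close>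

definition outward_unit_normal_at :: "'a::euclidean_space set \<Rightarrow> 'a \<Rightarrow> 'a \<Rightarrow> bool" where
  "outward_unit_normal_at \<omega> x \<nu> \<longleftrightarrow> norm \<nu> = 1 \<and>
     (\<forall>\<epsilon>>0. \<exists>\<delta>>0. \<forall>y \<in> ball x \<delta>.
        ((y - x) \<bullet> \<nu> < - \<epsilon> * norm (y - x) \<longrightarrow> y \<in> \<omega>) \<and>
        ((y - x) \<bullet> \<nu> > \<epsilon> * norm (y - x) \<longrightarrow> y \<notin> \<omega>))"

definition smooth_domain :: "'a::euclidean_space set \<Rightarrow> bool" where
  "smooth_domain \<omega> \<longleftrightarrow> open \<omega> \<and> connected \<omega> \<and> \<omega> \<noteq> {} \<and>
     (\<forall>x \<in> frontier \<omega>. \<exists>U \<psi>. open U \<and> x \<in> U \<and> smooth_fun \<psi> \<and>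
        (\<forall>y\<in>U. frechet_derivative \<psi> (at y) \<noteq> (\<lambda>_. 0)) \<and> \<omega> \<inter> U = {y \<in> U. \<psi> y < 0})"

text \<open>Data that do not depend on the discretisation. The local spaces \<open>poly_d\<close> and \<open>poly_0\<close> consist
  of polynomials on the whole space, to be restricted to the cells.\<close>

record 'a setting =
  Omega :: "'a set"
  Gamma_u :: "'a set"
  Gamma_p :: "'a set"
  normal :: "'a \<Rightarrow> 'a"
  Omega_ext :: "'a set"
  poly_d :: "('a \<Rightarrow> 'a) set"
  poly_0 :: "('a \<Rightarrow> real) set"

definition admissible_geometry :: "'a::euclidean_space setting \<Rightarrow> bool" where
  "admissible_geometry S \<longleftrightarrow>
     open (Omega S) \<and>
     (\<exists>P :: 'a set. open_polyhedral_domain P \<and> Omega S homeomorphic P) \<and>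
     Gamma_u S \<union> Gamma_p S = frontier (Omega S) \<and> Gamma_u S \<inter> Gamma_p S = {} \<and>
     Gamma_u S \<in> sets borel \<and> Gamma_p S \<in> sets borel \<and>
     emeasure surface_measure (frontier (Omega S)) < \<infinity> \<and>
     normal S \<in> borel_measurable (surface_on (frontier (Omega S))) \<and>
     (AE x in surface_on (frontier (Omega S)). outward_unit_normal_at (Omega S) x (normal S x)) \<and>
     smooth_domain (Omega_ext S)"

definition polynomial_local_space ::
    "('a::euclidean_space \<Rightarrow> 'b::euclidean_space) set \<Rightarrow> bool" where
  "polynomial_local_space P \<longleftrightarrow> linear_space P \<and> (\<exists>m. P \<subseteq> polys m)"


section \<open>Discretisations\<close>

text \<open>One discretisation: a background mesh, with the interpolators and stabilisation forms on it.\<close>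

record 'a discretisation =
  mesh_size :: real
  background :: "'a set"
  bg_mesh :: "'a set set"
  interp_d :: "('a \<Rightarrow> 'a) \<Rightarrow> 'a \<Rightarrow> 'a"
  interp_0 :: "('a \<Rightarrow> real) \<Rightarrow> 'a \<Rightarrow> real"
  stab_d :: "('a \<Rightarrow> 'a) \<Rightarrow> ('a \<Rightarrow> 'a) \<Rightarrow> real"
  stab_0 :: "('a \<Rightarrow> real) \<Rightarrow> ('a \<Rightarrow> real) \<Rightarrow> real"

definition conforming_mesh :: "'a::euclidean_space set \<Rightarrow> 'a set set \<Rightarrow> bool" where
  "conforming_mesh B \<T> \<longleftrightarrow> finite \<T> \<and> \<Union>\<T> = closure B \<and>
     (\<forall>T\<in>\<T>. polytope T \<and> interior T \<noteq> {}) \<and>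
     (\<forall>T\<in>\<T>. \<forall>T'\<in>\<T>. (T \<inter> T') face_of T \<and> (T \<inter> T') face_of T')"

definition active_cells :: "'a::euclidean_space setting \<Rightarrow> 'a discretisation \<Rightarrow> 'a set set" where
  "active_cells S D = {T \<in> bg_mesh D. T \<inter> Omega S \<noteq> {}}"

definition Omega_h :: "'a::euclidean_space setting \<Rightarrow> 'a discretisation \<Rightarrow> 'a set" where
  "Omega_h S D = interior (closure (\<Union>(active_cells S D)))"

definition V_d :: "'a::euclidean_space setting \<Rightarrow> 'a discretisation \<Rightarrow> ('a \<Rightarrow> 'a) set" where
  "V_d S D = {v \<in> Hdiv (Omega_h S D).
     \<forall>T \<in> active_cells S D. \<exists>p \<in> poly_d S. AE x in lebesgue_on T. v x = p x}"

definition V_0 :: "'a::euclidean_space setting \<Rightarrow> 'a discretisation \<Rightarrow> ('a \<Rightarrow> real) set" where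
  "V_0 S D = {q \<in> L2_space (lebesgue_on (Omega_h S D)).
     \<forall>T \<in> active_cells S D. \<exists>p \<in> poly_0 S. AE x in lebesgue_on T. q x = p x}"

abbreviation Div :: "'a::euclidean_space setting \<Rightarrow> 'a discretisation \<Rightarrow> ('a \<Rightarrow> 'a) \<Rightarrow> 'a \<Rightarrow> real" where
  "Div S D v \<equiv> weak_div (Omega_h S D) v"

abbreviation ae_eq :: "'a::euclidean_space set \<Rightarrow> ('a \<Rightarrow> 'b) \<Rightarrow> ('a \<Rightarrow> 'b) \<Rightarrow> bool" where
  "ae_eq \<omega> u v \<equiv> (AE x in lebesgue_on \<omega>. u x = v x)"

text \<open>The uniformity of constants with respect to \<open>h\<close> and to the cut location is expressed by
  a family of discretisations over an arbitrary index type: the constants may not depend on the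
  index.\<close>

definition mesh_family ::
    "'a::euclidean_space setting \<Rightarrow> real \<Rightarrow> ('i \<Rightarrow> 'a discretisation) \<Rightarrow> bool" where
  "mesh_family S h0 D \<longleftrightarrow>
     (\<forall>i. 0 < mesh_size (D i) \<and> mesh_size (D i) \<le> h0 \<and>
          open (background (D i)) \<and> connected (background (D i)) \<and>
          Omega S \<subseteq> background (D i) \<and>
          conforming_mesh (background (D i)) (bg_mesh (D i)) \<and>
          Omega_h S (D i) \<subseteq> Omega_ext S) \<and>
     (\<exists>c>0. \<exists>C>0. \<forall>i. \<forall>T \<in> bg_mesh (D i).
          c * mesh_size (D i) \<le> diameter T \<and> diameter T \<le> C * mesh_size (D i)) \<and>
     (\<exists>\<rho>>0. \<forall>i. \<forall>T \<in> bg_mesh (D i). \<exists>x. ball x (\<rho> * diameter T) \<subseteq> T)"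

definition contains_polys ::
    "'a::euclidean_space set set \<Rightarrow> nat \<Rightarrow> ('a \<Rightarrow> 'b::euclidean_space) set \<Rightarrow> bool" where
  "contains_polys \<T> k P \<longleftrightarrow> (\<forall>T\<in>\<T>. \<forall>p \<in> polys k. \<exists>q\<in>P. \<forall>x\<in>T. p x = q x)"

definition largest_degree ::
    "('i \<Rightarrow> 'a::euclidean_space set set) \<Rightarrow> ('a \<Rightarrow> 'b::euclidean_space) set \<Rightarrow> nat \<Rightarrow> bool" where
  "largest_degree \<T> P k \<longleftrightarrow> (\<forall>i. contains_polys (\<T> i) k P) \<and>
     (\<forall>k'. (\<forall>i. contains_polys (\<T> i) k' P) \<longrightarrow> k' \<le> k)"

definition interpolator ::
    "'a::euclidean_space set \<Rightarrow> ('a \<Rightarrow> 'b::euclidean_space) set \<Rightarrow> (('a \<Rightarrow> 'b) \<Rightarrow> 'a \<Rightarrow> 'b) \<Rightarrow> bool" where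
  "interpolator \<omega> V J \<longleftrightarrow>
     (\<forall>u \<in> L2_space (lebesgue_on \<omega>). J u \<in> V) \<and>
     (\<forall>u \<in> L2_space (lebesgue_on \<omega>). \<forall>v \<in> L2_space (lebesgue_on \<omega>). \<forall>c::real.
        ae_eq \<omega> (J (\<lambda>x. u x + c *\<^sub>R v x)) (\<lambda>x. J u x + c *\<^sub>R J v x)) \<and>
     (\<forall>v\<in>V. ae_eq \<omega> (J v) v)"

text \<open>The case \<open>r = 0\<close> of the error bounds makes the interpolators bounded in L2.\<close>

definition de_Rham_interpolation ::
    "'a::euclidean_space setting \<Rightarrow> ('i \<Rightarrow> 'a discretisation) \<Rightarrow> nat \<Rightarrow> nat \<Rightarrow> bool" where
  "de_Rham_interpolation S D ku kp \<longleftrightarrow>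
     (\<forall>i. interpolator (Omega_h S (D i)) (V_d S (D i)) (interp_d (D i)) \<and>
          interpolator (Omega_h S (D i)) (V_0 S (D i)) (interp_0 (D i)) \<and>
          (\<forall>v \<in> Hdiv (Omega_h S (D i)).
             ae_eq (Omega_h S (D i)) (Div S (D i) (interp_d (D i) v))
                                     (interp_0 (D i) (Div S (D i) v))) \<and>
          (\<forall>v \<in> V_d S (D i). Div S (D i) v \<in> V_0 S (D i)) \<and>
          (\<forall>q \<in> V_0 S (D i). \<exists>v \<in> V_d S (D i). ae_eq (Omega_h S (D i)) (Div S (D i) v) q)) \<and>
     (\<forall>r \<le> ku + 1. \<exists>C>0. \<forall>i. \<forall>u \<in> Sobolev r (Omega_h S (D i)).
          L2_norm (lebesgue_on (Omega_h S (D i))) (\<lambda>x. u x - interp_d (D i) u x)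
            \<le> C * mesh_size (D i) ^ r * Sobolev_norm r (Omega_h S (D i)) u) \<and>
     (\<forall>t \<le> kp + 1. \<exists>C>0. \<forall>i. \<forall>p \<in> Sobolev t (Omega_h S (D i)).
          L2_norm (lebesgue_on (Omega_h S (D i))) (\<lambda>x. p x - interp_0 (D i) p x)
            \<le> C * mesh_size (D i) ^ t * Sobolev_norm t (Omega_h S (D i)) p)"

text \<open>Bilinear forms on a space of functions identified almost everywhere.\<close>

definition bilinear_on ::
    "'a::euclidean_space set \<Rightarrow> ('a \<Rightarrow> 'b::euclidean_space) set \<Rightarrow>
     (('a \<Rightarrow> 'b) \<Rightarrow> ('a \<Rightarrow> 'b) \<Rightarrow> real) \<Rightarrow> bool" where
  "bilinear_on \<omega> V s \<longleftrightarrow>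
     (\<forall>u\<in>V. \<forall>u'\<in>V. \<forall>v\<in>V. \<forall>c. s (\<lambda>x. u x + c *\<^sub>R u' x) v = s u v + c * s u' v) \<and>
     (\<forall>u\<in>V. \<forall>v\<in>V. \<forall>v'\<in>V. \<forall>c. s u (\<lambda>x. v x + c *\<^sub>R v' x) = s u v + c * s u v') \<and>
     (\<forall>u\<in>V. \<forall>u'\<in>V. \<forall>v\<in>V. \<forall>v'\<in>V. ae_eq \<omega> u u' \<and> ae_eq \<omega> v v' \<longrightarrow> s u v = s u' v')"

definition stabilisation ::
    "'a::euclidean_space setting \<Rightarrow> ('i \<Rightarrow> 'a discretisation) \<Rightarrow> nat \<Rightarrow> nat \<Rightarrow> bool" where
  "stabilisation S D ku kp \<longleftrightarrow>
     (\<forall>i. bilinear_on (Omega_h S (D i)) (V_d S (D i)) (stab_d (D i)) \<and>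
          bilinear_on (Omega_h S (D i)) (V_0 S (D i)) (stab_0 (D i))) \<and>
     (\<exists>c>0. \<exists>C>0. \<forall>i. \<forall>w \<in> V_d S (D i).
        c * (L2_norm (lebesgue_on (Omega_h S (D i))) w)\<^sup>2
          \<le> (L2_norm (lebesgue_on (Omega S)) w)\<^sup>2 + stab_d (D i) w w \<and>
        (L2_norm (lebesgue_on (Omega S)) w)\<^sup>2 + stab_d (D i) w w
          \<le> C * (L2_norm (lebesgue_on (Omega_h S (D i))) w)\<^sup>2) \<and>
     (\<exists>c>0. \<exists>C>0. \<forall>i. \<forall>r \<in> V_0 S (D i).
        c * (L2_norm (lebesgue_on (Omega_h S (D i))) r)\<^sup>2
          \<le> (L2_norm (lebesgue_on (Omega S)) r)\<^sup>2 + stab_0 (D i) r r \<and>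
        (L2_norm (lebesgue_on (Omega S)) r)\<^sup>2 + stab_0 (D i) r r
          \<le> C * (L2_norm (lebesgue_on (Omega_h S (D i))) r)\<^sup>2) \<and>
     (\<forall>s \<le> ku + 1. \<exists>C>0. \<forall>i. \<forall>w \<in> Sobolev s (Omega_ext S). \<forall>v \<in> V_d S (D i).
        stab_d (D i) (interp_d (D i) w) v
          \<le> C * mesh_size (D i) ^ s * Sobolev_norm s (Omega_ext S) w
              * L2_norm (lebesgue_on (Omega_h S (D i))) v) \<and>
     (\<forall>t \<le> kp + 1. \<exists>C>0. \<forall>i. \<forall>r \<in> Sobolev t (Omega_ext S). \<forall>q \<in> V_0 S (D i).
        stab_0 (D i) (interp_0 (D i) r) q
          \<le> C * mesh_size (D i) ^ t * Sobolev_norm t (Omega_ext S) r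
              * L2_norm (lebesgue_on (Omega_h S (D i))) q) \<and>
     (\<forall>i. \<forall>c::real. \<forall>q \<in> V_0 S (D i). stab_0 (D i) (\<lambda>x. c) q = 0)"


section \<open>The discrete problem\<close>

text \<open>The polynomial with which a discrete function coincides on a cell.\<close>

definition cell_poly :: "('a::euclidean_space \<Rightarrow> 'b) set \<Rightarrow> 'a set \<Rightarrow> ('a \<Rightarrow> 'b) \<Rightarrow> 'a \<Rightarrow> 'b" where
  "cell_poly P T v = (SOME p. p \<in> P \<and> (AE x in lebesgue_on T. v x = p x))"

text \<open>Trace on the boundary, taken from inside \<open>Omega\<close>: the value at \<open>x\<close> of the polynomial of the
  active cell whose part inside \<open>Omega\<close> is adjacent to \<open>x\<close>. At points adjacent to several such parts
  (where the boundary crosses the mesh skeleton) the values are averaged.\<close>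

definition bdry_trace ::
    "'a::euclidean_space setting \<Rightarrow> 'a discretisation \<Rightarrow> ('a \<Rightarrow> 'b::euclidean_space) set \<Rightarrow>
     ('a \<Rightarrow> 'b) \<Rightarrow> 'a \<Rightarrow> 'b" where
  "bdry_trace S D P v x =
     (let A = {T \<in> active_cells S D. x \<in> closure (interior T \<inter> Omega S)}
      in (1 / real (card A)) *\<^sub>R (\<Sum>T\<in>A. cell_poly P T v x))"

definition normal_trace ::
    "'a::euclidean_space setting \<Rightarrow> 'a discretisation \<Rightarrow> ('a \<Rightarrow> 'a) \<Rightarrow> 'a \<Rightarrow> real" where
  "normal_trace S D v x = bdry_trace S D (poly_d S) v x \<bullet> normal S x"

definition a_h :: "'a::euclidean_space setting \<Rightarrow> 'a discretisation \<Rightarrow> real \<Rightarrow> real \<Rightarrow>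
    ('a \<Rightarrow> 'a) \<Rightarrow> ('a \<Rightarrow> 'a) \<Rightarrow> real" where
  "a_h S D \<gamma> \<tau>d u v =
     L2_inner (lebesgue_on (Omega S)) u v
     + \<gamma> * inverse (mesh_size D)
         * L2_inner (surface_on (Gamma_u S)) (normal_trace S D u) (normal_trace S D v)
     + \<tau>d * stab_d D u v"

definition b_h :: "'a::euclidean_space setting \<Rightarrow> 'a discretisation \<Rightarrow> real \<Rightarrow>
    ('a \<Rightarrow> 'a) \<Rightarrow> ('a \<Rightarrow> real) \<Rightarrow> real" where
  "b_h S D \<tau>0 v p =
     - L2_inner (lebesgue_on (Omega S)) (Div S D v) p - \<tau>0 * stab_0 D (Div S D v) p"

definition b_tilde_h :: "'a::euclidean_space setting \<Rightarrow> 'a discretisation \<Rightarrow> real \<Rightarrow>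
    ('a \<Rightarrow> 'a) \<Rightarrow> ('a \<Rightarrow> real) \<Rightarrow> real" where
  "b_tilde_h S D \<tau>0 v p =
     b_h S D \<tau>0 v p
     + L2_inner (surface_on (Gamma_u S)) (normal_trace S D v) (bdry_trace S D (poly_0 S) p)"

definition pressure_space :: "'a::euclidean_space setting \<Rightarrow> 'a discretisation \<Rightarrow> ('a \<Rightarrow> real) set" where
  "pressure_space S D =
     (if Gamma_p S = {} then {q \<in> V_0 S D. (\<integral>x. q x \<partial>lebesgue_on (Omega S)) = 0} else V_0 S D)"

definition discrete_solution :: "'a::euclidean_space setting \<Rightarrow> 'a discretisation \<Rightarrow>
    real \<Rightarrow> real \<Rightarrow> real \<Rightarrow> ('a \<Rightarrow> 'a) \<Rightarrow> ('a \<Rightarrow> real) \<Rightarrow> ('a \<Rightarrow> real) \<Rightarrow> ('a \<Rightarrow> real) \<Rightarrow>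
    ('a \<Rightarrow> 'a) \<Rightarrow> ('a \<Rightarrow> real) \<Rightarrow> bool" where
  "discrete_solution S D \<gamma> \<tau>d \<tau>0 f g u\<Gamma> p\<Gamma> u p \<longleftrightarrow>
     u \<in> V_d S D \<and> p \<in> pressure_space S D \<and>
     (\<forall>v \<in> V_d S D.
        a_h S D \<gamma> \<tau>d u v + b_tilde_h S D \<tau>0 v p
        = L2_inner (lebesgue_on (Omega S)) f v
          + \<gamma> * inverse (mesh_size D)
              * L2_inner (surface_on (Gamma_u S)) u\<Gamma> (normal_trace S D v)
          - L2_inner (surface_on (Gamma_p S)) (normal_trace S D v) p\<Gamma>) \<and>
     (\<forall>q \<in> pressure_space S D.
        b_h S D \<tau>0 u q = L2_inner (lebesgue_on (Omega S)) g q)"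

definition is_the_discrete_solution :: "'a::euclidean_space setting \<Rightarrow> 'a discretisation \<Rightarrow>
    real \<Rightarrow> real \<Rightarrow> real \<Rightarrow> ('a \<Rightarrow> 'a) \<Rightarrow> ('a \<Rightarrow> real) \<Rightarrow> ('a \<Rightarrow> real) \<Rightarrow> ('a \<Rightarrow> real) \<Rightarrow>
    ('a \<Rightarrow> 'a) \<Rightarrow> ('a \<Rightarrow> real) \<Rightarrow> bool" where
  "is_the_discrete_solution S D \<gamma> \<tau>d \<tau>0 f g u\<Gamma> p\<Gamma> u p \<longleftrightarrow>
     discrete_solution S D \<gamma> \<tau>d \<tau>0 f g u\<Gamma> p\<Gamma> u p \<and>
     (\<forall>u' p'. discrete_solution S D \<gamma> \<tau>d \<tau>0 f g u\<Gamma> p\<Gamma> u' p' \<longrightarrow>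
        ae_eq (Omega_h S D) u' u \<and> ae_eq (Omega_h S D) p' p)"

definition stab_proj :: "'a::euclidean_space setting \<Rightarrow> 'a discretisation \<Rightarrow> real \<Rightarrow>
    ('a \<Rightarrow> real) \<Rightarrow> 'a \<Rightarrow> real" where
  "stab_proj S D \<tau>0 r =
     (SOME z. z \<in> V_0 S D \<and>
        (\<forall>q \<in> V_0 S D. L2_inner (lebesgue_on (Omega S)) z q + \<tau>0 * stab_0 D z q
                        = L2_inner (lebesgue_on (Omega S)) r q))"

end

theory Submission
  imports Defs "HOL-Library.Function_Algebras"
begin

text \<open>Write \<open>A(z, q) = (z, q) + \<tau>0 s0(z, q)\<close> for the form on \<open>V_0\<close> that defines the stabilised
  projection, with the inner product taken over \<open>\<Omega>\<close>. The divergence maps \<open>V_d\<close> into \<open>V_0\<close>, and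
  \<open>b_h(v, q) = - A(div v, q)\<close> by definition. Hence the second discrete equation and the definition of the projection
  say together that \<open>d = div u_h + \<pi>(g)\<close> satisfies \<open>A(d, q) = 0\<close> for all discrete pressures \<open>q\<close>.
  If the pressure space is \<open>V_0\<close>, then \<open>d = 0\<close> as soon as \<open>A\<close> is nondegenerate. If it consists of the
  functions with mean zero, then, because \<open>s0\<close> vanishes on constants, \<open>A(1, q)\<close> is the integral of \<open>q\<close>;
  a constant \<open>c\<close> can therefore be chosen with \<open>A(d - c, q) = 0\<close> on all of \<open>V_0\<close>, and again \<open>d = c\<close>.

  The main point is the nondegeneracy of \<open>A\<close>. The form \<open>s0\<close> may be indefinite and nonsymmetric, so for
  large \<open>\<tau>0\<close> there is no coercivity to rely on. The nondegeneracy comes from the unique solvability of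
  the discrete problem. That problem is a square linear system on the product of \<open>V_d\<close> and the
  pressure space, so uniqueness implies solvability for every right-hand side. Solving it with an
  arbitrary right-hand side in the second equation shows that every functional on the pressure space
  is of the form \<open>A(div v, _)\<close> (\<open>unique_solvability_imp_stab_form_onto_pressure\<close>), hence that \<open>z \<mapsto> A(z, _)\<close> maps
  \<open>V_0\<close> onto its dual (\<open>stab_form_onto\<close>). In finite dimension it is then injective
  (\<open>stab_form_injective\<close>), and the projection is well defined (\<open>stab_proj\<close>).

  Discrete functions are determined only up to null sets, so the linear algebra is done modulo
  null functions (\<open>nondegenerate_form_represents_functionals\<close>). Two analytic facts make the discrete
  problem linear. The divergence is a chosen representative of the weak divergence, and its linearity
  rests on uniqueness of weak divergences in \<open>V_0\<close> (\<open>weak_div_unique\<close>); for piecewise polynomials this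
  only takes bump functions inside the cells. The boundary integrals are additive because traces of
  discrete functions are bounded and measurable on a boundary of finite measure.\<close>

section \<open>Nondegenerate forms modulo a subspace\<close>

text \<open>Pointwise operations make the functions into a real vector space, so that span,
  independence and linear maps can be used for the discrete spaces.\<close>

instantiation "fun" :: (type, real_vector) real_vector
begin

definition scaleR_fun :: "real \<Rightarrow> ('a \<Rightarrow> 'b) \<Rightarrow> 'a \<Rightarrow> 'b" where
  "scaleR_fun c f = (\<lambda>x. c *\<^sub>R f x)"

instance
  by standard (simp_all add: scaleR_fun_def fun_eq_iff scaleR_add_right scaleR_add_left)

end

lemma scaleR_fun_apply [simp]: "(c *\<^sub>R f) x = c *\<^sub>R f x"
  by (simp add: scaleR_fun_def)

lemma sum_fun_apply: "(\<Sum>i\<in>I. F i) x = (\<Sum>i\<in>I. F i x)" for F :: "'i \<Rightarrow> 'a \<Rightarrow> 'b::comm_monoid_add"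
  by (induction I rule: infinite_finite_induct) auto

lemma linear_space_iff_subspace: "linear_space V \<longleftrightarrow> subspace V"
proof
  assume V: "linear_space V"
  show "subspace V"
    unfolding subspace_def
  proof (intro conjI ballI allI)
    show 0: "0 \<in> V" using V by (simp add: linear_space_def zero_fun_def)
    have *: "u + c *\<^sub>R v \<in> V" if "u \<in> V" "v \<in> V" for u v c
    proof -
      have "u + c *\<^sub>R v = (\<lambda>x. u x + c *\<^sub>R v x)" by (simp add: fun_eq_iff)
      thus ?thesis using V that unfolding linear_space_def by simp
    qed
    show "u + v \<in> V" if "u \<in> V" "v \<in> V" for u v using *[OF that, of 1] by simp
    show "c *\<^sub>R v \<in> V" if "v \<in> V" for c v using *[OF 0 that, of c] by simp
  qed
next
  assume V: "subspace V"
  show "linear_space V"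
    unfolding linear_space_def
  proof (intro conjI ballI allI)
    show "(\<lambda>x. 0) \<in> V" using subspace_0[OF V] by (simp add: zero_fun_def)
    fix u v :: "'a \<Rightarrow> 'b" and c :: real assume "u \<in> V" "v \<in> V"
    hence "u + c *\<^sub>R v \<in> V" using V by (simp add: subspace_add subspace_scale)
    moreover have "u + c *\<^sub>R v = (\<lambda>x. u x + c *\<^sub>R v x)" by (simp add: fun_eq_iff)
    ultimately show "(\<lambda>x. u x + c *\<^sub>R v x) \<in> V" by simp
  qed
qed

text \<open>A linear map with prescribed kernel stands in for the quotient map: extend a basis of \<open>N\<close> to the
  whole space and send the basis vectors of \<open>N\<close> to zero.\<close>

lemma linear_with_kernel:
  fixes N :: "'v::real_vector set"
  assumes "subspace N"
  obtains \<pi> :: "'v \<Rightarrow> 'v" where "linear \<pi>" "\<And>x. \<pi> x = 0 \<longleftrightarrow> x \<in> N"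
proof -
  obtain C where C: "C \<subseteq> N" "independent C" "N \<subseteq> span C"
    using maximal_independent_subset by blast
  have spC: "span C = N"
    using C assms by (metis span_eq span_minimal subset_antisym)
  obtain E where E: "C \<subseteq> E" "independent E" "UNIV \<subseteq> span E"
    using maximal_independent_subset_extend[OF _ C(2), of UNIV] by auto
  obtain \<pi> :: "'v \<Rightarrow> 'v" where lin: "linear \<pi>" and \<pi>: "\<And>b. b \<in> E \<Longrightarrow> \<pi> b = (if b \<in> C then 0 else b)"
    using linear_independent_extend[OF E(2), of "\<lambda>b. if b \<in> C then 0 else b"] by blast
  have "\<pi> x = 0 \<longleftrightarrow> x \<in> N" for x
  proof
    assume "x \<in> N"
    hence "x \<in> span C" using spC by simp
    then show "\<pi> x = 0"
      using E(1) by (intro linear_eq_0_on_span[OF lin _ \<open>x \<in> span C\<close>]) (auto simp: \<pi>)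
  next
    assume 0: "\<pi> x = 0"
    obtain t r where t: "finite t" "t \<subseteq> E" "x = (\<Sum>a\<in>t. r a *\<^sub>R a)"
      using E(3) unfolding span_explicit by blast
    have "\<pi> x = (\<Sum>a\<in>t. r a *\<^sub>R \<pi> a)"
      by (simp add: t(3) linear_sum[OF lin] linear_cmul[OF lin])
    also have "\<dots> = (\<Sum>a\<in>t - C. r a *\<^sub>R a)"
      using t by (intro sum.mono_neutral_cong_right) (auto simp: \<pi> subset_iff)
    finally have "(\<Sum>a\<in>t - C. r a *\<^sub>R a) = 0" using 0 by simp
    moreover have "independent (t - C)"
      using E(2) t(2) by (meson Diff_subset independent_mono subset_trans)
    ultimately have r0: "r a = 0" if "a \<in> t - C" for a
      using independentD[OF _ _ subset_refl, of "t - C" r a] t(1) that by auto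
    have "x = (\<Sum>a\<in>t \<inter> C. r a *\<^sub>R a)"
      unfolding t(3) using t(1) r0 by (intro sum.mono_neutral_right) auto
    also have "\<dots> \<in> span C" by (intro span_sum span_scale span_base) auto
    finally show "x \<in> N" using spC by simp
  qed
  with lin that show ?thesis by blast
qed

lemma linear_injective_on_span_surjective:
  fixes T :: "'v::real_vector \<Rightarrow> 'v"
  assumes lin: "linear T" and fin: "finite B" and ind: "independent B"
    and maps: "T ` span B \<subseteq> span B" and inj: "\<And>x. x \<in> span B \<Longrightarrow> T x = 0 \<Longrightarrow> x = 0"
  shows "T ` span B = span B"
proof -
  have injon: "inj_on T (span B)"
  proof (rule inj_onI)
    fix x y assume "x \<in> span B" "y \<in> span B" "T x = T y"
    hence "x - y = 0" by (intro inj[OF span_diff]) (simp_all add: linear_diff[OF lin])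
    thus "x = y" by simp
  qed
  have indT: "independent (T ` B)"
    using linear_independent_injective_image[OF lin ind injon] .
  have card: "card (T ` B) = card B"
    by (rule card_image[OF inj_on_subset[OF injon span_superset]])
  have sub: "T ` B \<subseteq> span B" by (rule subset_trans[OF image_mono[OF span_superset] maps])
  have "span B \<subseteq> span (T ` B)"
  proof (rule ccontr)
    assume "\<not> span B \<subseteq> span (T ` B)"
    then obtain y where y: "y \<in> span B" "y \<notin> span (T ` B)" by blast
    have "insert y (T ` B) \<subseteq> span B" using y(1) sub by blast
    with independent_span_bound[OF fin independent_insertI[OF y(2) indT]]
    have le: "card (insert y (T ` B)) \<le> card B" by blast
    have "y \<notin> T ` B" using y(2) span_base[of y "T ` B"] by blast
    from card_insert_disjoint[OF finite_imageI[OF fin] this] show False using card le by linarith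
  qed
  hence "span B \<subseteq> T ` span B" unfolding linear_span_image[OF lin] .
  thus ?thesis using maps by blast
qed

text \<open>The finite-dimensional fact that a square system with a trivial kernel is solvable for every
  right-hand side, for a space \<open>X\<close> of finite dimension modulo \<open>N0\<close>. The kernel condition is on the
  first argument of \<open>M\<close> only, so the lemma can be applied to a form as well as to its transpose.\<close>

lemma nondegenerate_form_represents_functionals:
  fixes X N0 :: "'v::real_vector set" and M :: "'v \<Rightarrow> 'v \<Rightarrow> real" and l :: "'v \<Rightarrow> real"
  assumes X: "subspace X" and N0: "subspace N0" and fin: "finite B0"
    and spans: "\<And>x. x \<in> X \<Longrightarrow> \<exists>b\<in>span B0. x - b \<in> N0"
    and Mleft: "\<And>x x' y c. x \<in> X \<Longrightarrow> x' \<in> X \<Longrightarrow> y \<in> X \<Longrightarrow> M (x + c *\<^sub>R x') y = M x y + c * M x' y"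
    and Mright: "\<And>x y y' c. x \<in> X \<Longrightarrow> y \<in> X \<Longrightarrow> y' \<in> X \<Longrightarrow> M x (y + c *\<^sub>R y') = M x y + c * M x y'"
    and Mnull: "\<And>x y. x \<in> X \<Longrightarrow> y \<in> X \<Longrightarrow> y \<in> N0 \<Longrightarrow> M x y = 0"
    and nondeg: "\<And>x. x \<in> X \<Longrightarrow> (\<And>y. y \<in> X \<Longrightarrow> M x y = 0) \<Longrightarrow> x \<in> N0"
    and llin: "\<And>y y' c. y \<in> X \<Longrightarrow> y' \<in> X \<Longrightarrow> l (y + c *\<^sub>R y') = l y + c * l y'"
    and lnull: "\<And>y. y \<in> X \<Longrightarrow> y \<in> N0 \<Longrightarrow> l y = 0"
  shows "\<exists>x\<in>X. \<forall>y\<in>X. M x y = l y"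
proof -
  obtain \<pi> :: "'v \<Rightarrow> 'v" where lin: "linear \<pi>" and ker: "\<And>x. \<pi> x = 0 \<longleftrightarrow> x \<in> N0"
    using linear_with_kernel[OF N0] by blast
  have X0: "0 \<in> X" using X by (rule subspace_0)
  have \<pi>X: "\<pi> ` X \<subseteq> span (\<pi> ` B0)"
  proof
    fix y assume "y \<in> \<pi> ` X"
    then obtain x where x: "x \<in> X" "y = \<pi> x" by blast
    obtain b where b: "b \<in> span B0" "x - b \<in> N0" using spans[OF x(1)] by blast
    have "\<pi> x - \<pi> b = 0" using b(2) ker[of "x - b"] by (simp only: linear_diff[OF lin])
    hence "y = \<pi> b" using x(2) by simp
    thus "y \<in> span (\<pi> ` B0)" unfolding linear_span_image[OF lin] using b(1) by blast
  qed
  obtain B where B: "B \<subseteq> \<pi> ` X" "independent B" "\<pi> ` X \<subseteq> span B"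
    using maximal_independent_subset[of "\<pi> ` X"] by metis
  have finB: "finite B"
    using independent_span_bound[OF finite_imageI[OF fin] B(2) subset_trans[OF B(1) \<pi>X]] by simp
  have "\<forall>b\<in>B. \<exists>x. x \<in> X \<and> \<pi> x = b" using B(1) by blast
  from bchoice[OF this] obtain r where "\<forall>b\<in>B. r b \<in> X \<and> \<pi> (r b) = b" ..
  hence r: "r b \<in> X" "\<pi> (r b) = b" if "b \<in> B" for b using that by simp_all
  have M0: "M 0 y = 0" if "y \<in> X" for y using Mleft[OF X0 X0 that, of "1"] by simp
  have M0': "M x 0 = 0" if "x \<in> X" for x using Mright[OF that X0 X0, of "1"] by simp
  have l0: "l 0 = 0" using llin[OF X0 X0, of 1] by simp
  define comb where "comb k = (\<Sum>b\<in>B. k b *\<^sub>R r b)" for k :: "'v \<Rightarrow> real"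
  have combX: "(\<Sum>b\<in>A. k b *\<^sub>R r b) \<in> X" if "A \<subseteq> B" for k A
    using that r(1) by (intro subspace_sum[OF X] subspace_scale[OF X]) auto
  have Mcomb: "M (\<Sum>b\<in>A. k b *\<^sub>R r b) y = (\<Sum>b\<in>A. k b * M (r b) y)"
    if "finite A" "A \<subseteq> B" "y \<in> X" for k A y
    using that(1,2)
  proof (induction A)
    case empty thus ?case by (simp add: M0 that)
  next
    case (insert a A)
    have "M ((\<Sum>b\<in>A. k b *\<^sub>R r b) + k a *\<^sub>R r a) y = M (\<Sum>b\<in>A. k b *\<^sub>R r b) y + k a * M (r a) y"
      using insert that by (intro Mleft combX r(1)) auto
    thus ?case using insert by (simp add: add.commute)
  qed
  have Mcomb': "M x (\<Sum>b\<in>A. k b *\<^sub>R r b) = (\<Sum>b\<in>A. k b * M x (r b))"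
    and lcomb: "l (\<Sum>b\<in>A. k b *\<^sub>R r b) = (\<Sum>b\<in>A. k b * l (r b))"
    if "finite A" "A \<subseteq> B" "x \<in> X" for k A x
  proof -
    show "M x (\<Sum>b\<in>A. k b *\<^sub>R r b) = (\<Sum>b\<in>A. k b * M x (r b))"
      using that(1,2)
    proof (induction A)
      case empty thus ?case by (simp add: M0' that)
    next
      case (insert a A)
      have "M x ((\<Sum>b\<in>A. k b *\<^sub>R r b) + k a *\<^sub>R r a) = M x (\<Sum>b\<in>A. k b *\<^sub>R r b) + k a * M x (r a)"
        using insert that by (intro Mright combX r(1)) auto
      thus ?case using insert by (simp add: add.commute)
    qed
    show "l (\<Sum>b\<in>A. k b *\<^sub>R r b) = (\<Sum>b\<in>A. k b * l (r b))"
      using that(1,2)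
    proof (induction A)
      case empty thus ?case by (simp add: l0)
    next
      case (insert a A)
      have "l ((\<Sum>b\<in>A. k b *\<^sub>R r b) + k a *\<^sub>R r a) = l (\<Sum>b\<in>A. k b *\<^sub>R r b) + k a * l (r a)"
        using insert that by (intro llin combX r(1)) auto
      thus ?case using insert by (simp add: add.commute)
    qed
  qed
  have decomp: "\<exists>k. y - comb k \<in> N0" if "y \<in> X" for y
  proof -
    have "\<pi> y \<in> span B" using that B(3) by auto
    then obtain k where "\<pi> y = (\<Sum>b\<in>B. k b *\<^sub>R b)"
      unfolding span_finite[OF finB] by blast
    also have "\<dots> = \<pi> (comb k)"
      by (simp add: comb_def linear_sum[OF lin] linear_cmul[OF lin] r(2))
    finally have "\<pi> (y - comb k) = 0" by (simp add: linear_diff[OF lin])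
    thus ?thesis using ker by blast
  qed
  have cX: "comb k \<in> X" for k unfolding comb_def by (rule combX) auto
  \<comment> \<open>it suffices to test with the representatives \<open>r b\<close>; the case \<open>l' = 0\<close> gives injectivity\<close>
  have Mtest: "M x y = l' y"
    if x: "x \<in> X" and y: "y \<in> X" and eq: "\<And>b. b \<in> B \<Longrightarrow> M x (r b) = l' (r b)"
      and l': "l' = l \<or> l' = (\<lambda>_. 0)" for x y l'
  proof -
    obtain k where k: "y - comb k \<in> N0" using decomp[OF y] by blast
    have yX: "y - comb k \<in> X" using X y cX by (intro subspace_diff)
    have "M x (comb k) = l' (comb k)"
      using l' eq by (auto simp: comb_def Mcomb'[OF finB _ x] lcomb[OF finB _ x])
    moreover have "M x (comb k + 1 *\<^sub>R (y - comb k)) = M x (comb k) + 1 * 0"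
      using Mright[OF x cX yX, of k 1] Mnull[OF x yX k] by simp
    moreover have "l (comb k + 1 *\<^sub>R (y - comb k)) = l (comb k) + 1 * 0"
      using llin[OF cX yX, of k 1] lnull[OF yX k] by simp
    ultimately show ?thesis using l' by auto
  qed
  \<comment> \<open>the matrix of the system, as an endomorphism of the span of the basis \<open>B\<close> of \<open>\<pi> ` X\<close>\<close>
  obtain T :: "'v \<Rightarrow> 'v" where linT: "linear T"
    and T: "\<And>b0. b0 \<in> B \<Longrightarrow> T b0 = (\<Sum>b\<in>B. M (r b0) (r b) *\<^sub>R b)"
    using linear_independent_extend[OF B(2), of "\<lambda>b0. \<Sum>b\<in>B. M (r b0) (r b) *\<^sub>R b"] by blast
  have Tcomb: "T (\<Sum>b0\<in>B. k b0 *\<^sub>R b0) = (\<Sum>b\<in>B. M (comb k) (r b) *\<^sub>R b)" for k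
  proof -
    have "T (\<Sum>b0\<in>B. k b0 *\<^sub>R b0) = (\<Sum>b0\<in>B. \<Sum>b\<in>B. (k b0 * M (r b0) (r b)) *\<^sub>R b)"
      by (simp add: linear_sum[OF linT] linear_cmul[OF linT] T scaleR_sum_right)
    also have "\<dots> = (\<Sum>b\<in>B. \<Sum>b0\<in>B. (k b0 * M (r b0) (r b)) *\<^sub>R b)"
      by (rule sum.swap)
    also have "\<dots> = (\<Sum>b\<in>B. M (comb k) (r b) *\<^sub>R b)"
      using r(1) by (simp add: comb_def Mcomb[OF finB] scaleR_sum_left)
    finally show ?thesis .
  qed
  have span_rep: "\<exists>k. x = (\<Sum>b\<in>B. k b *\<^sub>R b)" if "x \<in> span B" for x
    using that unfolding span_finite[OF finB] by blast
  have "T ` span B = span B"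
  proof (rule linear_injective_on_span_surjective[OF linT finB B(2)])
    show "T ` span B \<subseteq> span B"
    proof
      fix y assume "y \<in> T ` span B"
      then obtain k where "y = T (\<Sum>b\<in>B. k b *\<^sub>R b)" using span_rep by blast
      thus "y \<in> span B" by (simp only: Tcomb) (intro span_sum span_scale span_base)
    qed
    fix x assume x: "x \<in> span B" "T x = 0"
    obtain k where k: "x = (\<Sum>b\<in>B. k b *\<^sub>R b)" using span_rep[OF x(1)] by blast
    have "(\<Sum>b\<in>B. M (comb k) (r b) *\<^sub>R b) = 0" using x(2) k Tcomb by simp
    hence "M (comb k) (r b) = 0" if "b \<in> B" for b
      using independentD[OF B(2) finB subset_refl _ that, of "\<lambda>b. M (comb k) (r b)"] by simp
    hence "M (comb k) y = 0" if "y \<in> X" for y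
      using Mtest[OF cX that, of k "\<lambda>_. 0"] by simp
    hence "comb k \<in> N0" using nondeg[OF cX] by blast
    hence "\<pi> (comb k) = 0" using ker by blast
    thus "x = 0" by (simp add: k comb_def linear_sum[OF lin] linear_cmul[OF lin] r(2))
  qed
  moreover have "(\<Sum>b\<in>B. l (r b) *\<^sub>R b) \<in> span B" by (intro span_sum span_scale span_base)
  ultimately obtain x where x: "x \<in> span B" "T x = (\<Sum>b\<in>B. l (r b) *\<^sub>R b)" by (metis imageE)
  obtain k where k: "x = (\<Sum>b\<in>B. k b *\<^sub>R b)" using span_rep[OF x(1)] by blast
  have "(\<Sum>b\<in>B. (M (comb k) (r b) - l (r b)) *\<^sub>R b) = 0"
    using x(2) k Tcomb by (simp add: scaleR_diff_left sum_subtractf)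
  hence "M (comb k) (r b) = l (r b)" if "b \<in> B" for b
    using independentD[OF B(2) finB subset_refl _ that, of "\<lambda>b. M (comb k) (r b) - l (r b)"] by simp
  hence "M (comb k) y = l y" if "y \<in> X" for y
    using Mtest[OF cX that, of k l] by simp
  thus ?thesis using cX by blast
qed

section \<open>Square integrable functions\<close>

lemma L2_lincomb:
  assumes "f \<in> L2_space M" "g \<in> L2_space M"
  shows "(\<lambda>x. f x + c *\<^sub>R g x) \<in> L2_space M"
proof -
  have m[measurable]: "f \<in> borel_measurable M" "g \<in> borel_measurable M"
    and i: "integrable M (\<lambda>x. (norm (f x))\<^sup>2)" "integrable M (\<lambda>x. (norm (g x))\<^sup>2)"
    using assms by (auto simp: L2_space_def)
  have "integrable M (\<lambda>x. 2 * (norm (f x))\<^sup>2 + 2 * c\<^sup>2 * (norm (g x))\<^sup>2)"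
    using i by (intro Bochner_Integration.integrable_add integrable_mult_right) auto
  hence "integrable M (\<lambda>x. (norm (f x + c *\<^sub>R g x))\<^sup>2)"
  proof (rule Bochner_Integration.integrable_bound)
    show "AE x in M. norm ((norm (f x + c *\<^sub>R g x))\<^sup>2)
            \<le> norm (2 * (norm (f x))\<^sup>2 + 2 * c\<^sup>2 * (norm (g x))\<^sup>2)"
    proof (rule AE_I2)
      fix x
      have "norm (f x + c *\<^sub>R g x) \<le> norm (f x) + \<bar>c\<bar> * norm (g x)"
        by (metis norm_scaleR norm_triangle_ineq)
      hence "(norm (f x + c *\<^sub>R g x))\<^sup>2 \<le> (norm (f x) + \<bar>c\<bar> * norm (g x))\<^sup>2"
        by (intro power_mono) auto
      also have "\<dots> \<le> 2 * (norm (f x))\<^sup>2 + 2 * c\<^sup>2 * (norm (g x))\<^sup>2"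
        using sum_squares_bound[of "norm (f x)" "\<bar>c\<bar> * norm (g x)"]
        by (simp add: power2_sum power_mult_distrib)
      finally show "norm ((norm (f x + c *\<^sub>R g x))\<^sup>2)
            \<le> norm (2 * (norm (f x))\<^sup>2 + 2 * c\<^sup>2 * (norm (g x))\<^sup>2)"
        by simp
    qed
  qed measurable
  thus ?thesis by (simp add: L2_space_def)
qed

lemma L2_inner_integrable:
  assumes "f \<in> L2_space M" "g \<in> L2_space M"
  shows "integrable M (\<lambda>x. f x \<bullet> g x)"
proof -
  have m[measurable]: "f \<in> borel_measurable M" "g \<in> borel_measurable M"
    and i: "integrable M (\<lambda>x. (norm (f x))\<^sup>2)" "integrable M (\<lambda>x. (norm (g x))\<^sup>2)"
    using assms by (auto simp: L2_space_def)
  have "integrable M (\<lambda>x. (norm (f x))\<^sup>2 + (norm (g x))\<^sup>2)" using i by auto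
  thus ?thesis
  proof (rule Bochner_Integration.integrable_bound)
    show "AE x in M. norm (f x \<bullet> g x) \<le> norm ((norm (f x))\<^sup>2 + (norm (g x))\<^sup>2)"
    proof (rule AE_I2)
      fix x
      have "\<bar>f x \<bullet> g x\<bar> \<le> norm (f x) * norm (g x)" by (rule Cauchy_Schwarz_ineq2)
      also have "\<dots> \<le> (norm (f x))\<^sup>2 + (norm (g x))\<^sup>2"
        using sum_squares_bound[of "norm (f x)" "norm (g x)"]
          mult_nonneg_nonneg[OF norm_ge_zero[of "f x"] norm_ge_zero[of "g x"]] by linarith
      finally show "norm (f x \<bullet> g x) \<le> norm ((norm (f x))\<^sup>2 + (norm (g x))\<^sup>2)"
        by simp
    qed
  qed measurable
qed

lemma L2_inner_lincomb_left:
  assumes "f \<in> L2_space M" "f' \<in> L2_space M" "g \<in> L2_space M"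
  shows "L2_inner M (\<lambda>x. f x + c *\<^sub>R f' x) g = L2_inner M f g + c * L2_inner M f' g"
  using L2_inner_integrable[OF assms(1,3)] L2_inner_integrable[OF assms(2,3)]
  by (simp add: L2_inner_def inner_add_left)

lemma L2_inner_commute: "L2_inner M f g = L2_inner M g f"
  by (simp add: L2_inner_def inner_commute)

lemma L2_inner_lincomb_right:
  assumes "f \<in> L2_space M" "g \<in> L2_space M" "g' \<in> L2_space M"
  shows "L2_inner M f (\<lambda>x. g x + c *\<^sub>R g' x) = L2_inner M f g + c * L2_inner M f g'"
  using L2_inner_lincomb_left[OF assms(2,3,1)] by (simp add: L2_inner_commute)

lemma L2_inner_zero_AE: "AE x in M. f x = 0 \<Longrightarrow> L2_inner M f g = 0"
  unfolding L2_inner_def by (rule integral_eq_zero_AE) auto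

lemma L2_inner_self_zero:
  assumes "f \<in> L2_space M" "L2_inner M f f = 0"
  shows "AE x in M. f x = 0"
proof -
  have "AE x in M. f x \<bullet> f x = 0"
    using assms(2) integral_nonneg_eq_0_iff_AE[OF L2_inner_integrable[OF assms(1,1)]]
    by (simp add: L2_inner_def)
  thus ?thesis by eventually_elim simp
qed

lemma L2_zero: "(\<lambda>x. 0) \<in> L2_space M"
  by (simp add: L2_space_def)

lemma L2_space_bounded:
  assumes "finite_measure M" "f \<in> borel_measurable M" "AE x in M. norm (f x) \<le> C"
  shows "f \<in> L2_space M"
proof -
  interpret finite_measure M by fact
  have "integrable M (\<lambda>x. (norm (f x))\<^sup>2)"
  proof (rule integrable_const_bound)
    show "AE x in M. norm ((norm (f x))\<^sup>2) \<le> C\<^sup>2"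
      using assms(3) by eventually_elim (auto intro: power_mono)
  qed (use assms(2) in measurable)
  thus ?thesis using assms(2) by (simp add: L2_space_def)
qed

lemma AE_lebesgue_on_subset:
  assumes "A \<in> sets lebesgue" "B \<in> sets lebesgue" "B \<subseteq> A" "AE x in lebesgue_on A. P x"
  shows "AE x in lebesgue_on B. P x"
  using assms by (auto simp: AE_restrict_space_iff elim!: eventually_mono)

lemma L2_space_subset:
  assumes A: "A \<in> sets lebesgue" and B: "B \<in> sets lebesgue" "B \<subseteq> A"
    and f: "f \<in> L2_space (lebesgue_on A)"
  shows "f \<in> L2_space (lebesgue_on B)"
proof -
  have m: "f \<in> borel_measurable (lebesgue_on B)"
    using f B(2) measurable_restrict_mono unfolding L2_space_def by blast
  have "integrable lebesgue (\<lambda>x. indicator A x *\<^sub>R (norm (f x))\<^sup>2)"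
    using f A by (simp add: L2_space_def integrable_restrict_space)
  hence "integrable lebesgue (\<lambda>x. indicator B x *\<^sub>R (indicator A x *\<^sub>R (norm (f x))\<^sup>2))"
    using B(1) by (rule integrable_mult_indicator[rotated])
  also have "(\<lambda>x. indicator B x *\<^sub>R (indicator A x *\<^sub>R (norm (f x))\<^sup>2)) =
      (\<lambda>x. indicator B x *\<^sub>R (norm (f x))\<^sup>2)"
    using B(2) by (auto simp: indicator_def fun_eq_iff)
  finally have "integrable (lebesgue_on B) (\<lambda>x. (norm (f x))\<^sup>2)"
    using B(1) by (simp add: integrable_restrict_space)
  thus ?thesis using m by (simp add: L2_space_def)
qed

lemma finite_measure_lebesgue_on_bounded:
  assumes "bounded \<omega>" "\<omega> \<in> sets lebesgue"
  shows "finite_measure (lebesgue_on \<omega>)"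
proof -
  have "\<omega> \<in> lmeasurable" using assms by (simp add: bounded_set_imp_lmeasurable)
  thus ?thesis by (rule finite_measure_lebesgue_on)
qed

lemma L2_space_continuous:
  fixes f :: "'a::euclidean_space \<Rightarrow> 'b::euclidean_space"
  assumes "bounded \<omega>" "\<omega> \<in> sets lebesgue" "continuous_on UNIV f"
  shows "f \<in> L2_space (lebesgue_on \<omega>)"
proof -
  have "compact (f ` closure \<omega>)"
    using assms by (intro compact_continuous_image continuous_on_subset[OF assms(3)]) auto
  from compact_imp_bounded[OF this] obtain C where C: "\<And>x. x \<in> closure \<omega> \<Longrightarrow> norm (f x) \<le> C"
    by (auto simp: bounded_iff)
  show ?thesis
  proof (rule L2_space_bounded)
    show "finite_measure (lebesgue_on \<omega>)" using assms by (intro finite_measure_lebesgue_on_bounded)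
    show "f \<in> borel_measurable (lebesgue_on \<omega>)"
      using assms by (intro continuous_imp_measurable_on_sets_lebesgue continuous_on_subset[OF assms(3)]) auto
    show "AE x in lebesgue_on \<omega>. norm (f x) \<le> C"
      using C closure_subset by (intro AE_I2) (auto simp: space_restrict_space)
  qed
qed

section \<open>Bump functions\<close>

text \<open>For \<open>n = 0\<close> this is the standard smooth function that is flat at the origin. The powers of \<open>1 / t\<close>
  are included because the derivatives of the \<open>flat_fun n\<close> are linear combinations of them again.\<close>

definition flat_fun :: "nat \<Rightarrow> real \<Rightarrow> real" where
  "flat_fun n t = (if t > 0 then exp (- inverse t) * inverse t ^ n else 0)"

lemma flat_fun_has_derivative:
  "(flat_fun n has_real_derivative flat_fun (n + 2) t - real n * flat_fun (n + 1) t) (at t)"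
proof (cases "t = 0")
  case True
  \<comment> \<open>with \<open>s = 1 / h\<close> the right-hand difference quotient is \<open>s ^ (n + 1) / exp s\<close>\<close>
  have "((\<lambda>h. flat_fun n h / h) \<longlongrightarrow> 0) (at 0)"
  proof (rule filterlim_split_at_real)
    show "((\<lambda>h. flat_fun n h / h) \<longlongrightarrow> 0) (at_left 0)"
    proof (rule tendsto_eventually)
      show "\<forall>\<^sub>F h in at_left 0. flat_fun n h / h = 0"
        using eventually_at_left_real[of "-1" 0] by (auto simp: flat_fun_def elim!: eventually_mono)
    qed
    have "((\<lambda>h. inverse h ^ (n + 1) / exp (inverse h)) \<longlongrightarrow> 0) (at_right (0::real))"
      by (rule filterlim_compose[OF tendsto_power_div_exp_0 filterlim_inverse_at_top_right])
    moreover have "\<forall>\<^sub>F h in at_right 0. flat_fun n h / h = inverse h ^ (n + 1) / exp (inverse h)"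
      using eventually_at_right_less[of "0::real"]
      by eventually_elim (auto simp: flat_fun_def exp_minus field_simps)
    ultimately show "((\<lambda>h. flat_fun n h / h) \<longlongrightarrow> 0) (at_right 0)"
      by (simp add: filterlim_cong)
  qed
  thus ?thesis using True by (simp add: DERIV_def flat_fun_def)
next
  case False
  consider "t > 0" | "t < 0" using False by linarith
  thus ?thesis
  proof cases
    case 1
    have "((\<lambda>t. exp (- inverse t) * inverse t ^ n) has_real_derivative
            exp (- inverse t) * (inverse t * inverse t) * inverse t ^ n
            + exp (- inverse t) * (real n * inverse t ^ (n - 1) * - (inverse t * inverse t))) (at t)"
      using 1 by (auto intro!: derivative_eq_intros simp: algebra_simps)
    also have "exp (- inverse t) * (inverse t * inverse t) * inverse t ^ n
            + exp (- inverse t) * (real n * inverse t ^ (n - 1) * - (inverse t * inverse t))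
        = flat_fun (n + 2) t - real n * flat_fun (n + 1) t"
      using 1 by (cases n) (simp_all add: flat_fun_def algebra_simps)
    finally have "((\<lambda>t. exp (- inverse t) * inverse t ^ n) has_real_derivative
            flat_fun (n + 2) t - real n * flat_fun (n + 1) t) (at t)" .
    moreover have "\<And>s. s \<in> {0<..} \<Longrightarrow> exp (- inverse s) * inverse s ^ n = flat_fun n s"
      by (simp add: flat_fun_def)
    ultimately show ?thesis
      using 1 by (auto intro: has_field_derivative_transform_within_open[of _ _ _ "{0<..}"])
  next
    case 2
    have "((\<lambda>t::real. 0::real) has_real_derivative flat_fun (n + 2) t - real n * flat_fun (n + 1) t) (at t)"
      using 2 by (simp add: flat_fun_def)
    moreover have "\<And>s. s \<in> {..<0} \<Longrightarrow> 0 = flat_fun n s"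
      by (simp add: flat_fun_def)
    ultimately show ?thesis
      using 2 by (auto intro: has_field_derivative_transform_within_open[of _ _ _ "{..<0}"])
  qed
qed

text \<open>An algebra that contains the bump \<open>exp (- 1 / (r\<^sup>2 - \<bar>x - z\<bar>\<^sup>2))\<close> and is closed under directional
  derivatives, so that all its members are smooth. Induction over its generation avoids any explicit
  formula for higher derivatives.\<close>

inductive_set radial_algebra :: "'a::euclidean_space \<Rightarrow> real \<Rightarrow> ('a \<Rightarrow> real) set" for z r where
  const: "(\<lambda>_. c) \<in> radial_algebra z r"
| coord: "(\<lambda>x. x \<bullet> b) \<in> radial_algebra z r"
| flat: "(\<lambda>x. flat_fun n (r\<^sup>2 - (x - z) \<bullet> (x - z))) \<in> radial_algebra z r"
| add: "f \<in> radial_algebra z r \<Longrightarrow> g \<in> radial_algebra z r \<Longrightarrow> (\<lambda>x. f x + g x) \<in> radial_algebra z r"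
| mult: "f \<in> radial_algebra z r \<Longrightarrow> g \<in> radial_algebra z r \<Longrightarrow> (\<lambda>x. f x * g x) \<in> radial_algebra z r"

lemma radial_algebra_derivative:
  assumes "f \<in> radial_algebra z r"
  shows "\<exists>f'. (\<forall>x. (f has_derivative f' x) (at x)) \<and> (\<forall>b. (\<lambda>x. f' x b) \<in> radial_algebra z r)"
  using assms
proof induction
  case (const c)
  show ?case by (rule exI[of _ "\<lambda>x h. 0"]) (auto intro: radial_algebra.const)
next
  case (coord b)
  show ?case
    by (rule exI[of _ "\<lambda>x h. h \<bullet> b"])
      (auto intro!: radial_algebra.const derivative_eq_intros)
next
  case (flat n)
  let ?g = "\<lambda>m x. flat_fun m (r\<^sup>2 - (x - z) \<bullet> (x - z))"
  let ?f' = "\<lambda>x h. (?g (n + 2) x + (- real n) * ?g (n + 1) x) * ((- 2) * (x \<bullet> h) + 2 * (z \<bullet> h))"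
  show ?case
  proof (rule exI[of _ ?f'], intro conjI allI)
    fix x
    have inner: "((\<lambda>x. r\<^sup>2 - (x - z) \<bullet> (x - z)) has_derivative (\<lambda>h. (- 2) * (x \<bullet> h) + 2 * (z \<bullet> h))) (at x)"
      by (auto intro!: derivative_eq_intros simp: algebra_simps inner_commute)
    have "(flat_fun n has_derivative
            (*) (flat_fun (n + 2) (r\<^sup>2 - (x - z) \<bullet> (x - z)) - real n * flat_fun (n + 1) (r\<^sup>2 - (x - z) \<bullet> (x - z))))
          (at (r\<^sup>2 - (x - z) \<bullet> (x - z)))"
      using flat_fun_has_derivative unfolding has_field_derivative_def .
    from has_derivative_compose[OF inner this]
    show "(?g n has_derivative ?f' x) (at x)" by simp
  next
    fix b
    show "(\<lambda>x. ?f' x b) \<in> radial_algebra z r"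
      by (intro radial_algebra.intros)
  qed
next
  case (add f g)
  then obtain f' g' where
    "\<forall>x. (f has_derivative f' x) (at x)" "\<forall>b. (\<lambda>x. f' x b) \<in> radial_algebra z r"
    "\<forall>x. (g has_derivative g' x) (at x)" "\<forall>b. (\<lambda>x. g' x b) \<in> radial_algebra z r"
    by blast
  thus ?case
    by (intro exI[of _ "\<lambda>x h. f' x h + g' x h"]) (auto intro!: radial_algebra.add has_derivative_add)
next
  case (mult f g)
  then obtain f' g' where *:
    "\<forall>x. (f has_derivative f' x) (at x)" "\<forall>b. (\<lambda>x. f' x b) \<in> radial_algebra z r"
    "\<forall>x. (g has_derivative g' x) (at x)" "\<forall>b. (\<lambda>x. g' x b) \<in> radial_algebra z r"
    by blast
  show ?case
  proof (rule exI[of _ "\<lambda>x h. f x * g' x h + f' x h * g x"], intro conjI allI)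
    fix x show "((\<lambda>x. f x * g x) has_derivative (\<lambda>h. f x * g' x h + f' x h * g x)) (at x)"
      using * by (intro has_derivative_mult) auto
  next
    fix b show "(\<lambda>x. f x * g' x b + f' x b * g x) \<in> radial_algebra z r"
      using * mult by (intro radial_algebra.add radial_algebra.mult) auto
  qed
qed

lemma radial_algebra_smooth:
  assumes "f \<in> radial_algebra z r"
  shows "smooth_fun f"
proof -
  have "iter_deriv bs f \<in> radial_algebra z r" for bs
  proof (induction bs)
    case (Cons b bs)
    then obtain f' where f': "\<forall>x. (iter_deriv bs f has_derivative f' x) (at x)"
      "\<forall>b. (\<lambda>x. f' x b) \<in> radial_algebra z r"
      using radial_algebra_derivative by blast
    have "frechet_derivative (iter_deriv bs f) (at x) = f' x" for x
      using f'(1) by (intro frechet_derivative_at[symmetric]) blast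
    thus ?case using f'(2) by simp
  qed (use assms in simp)
  thus ?thesis
    unfolding smooth_fun_def differentiable_def using radial_algebra_derivative by blast
qed

lemma exists_bump_function:
  fixes z :: "'a::euclidean_space"
  assumes "r > 0" "cball z r \<subseteq> \<omega>"
  obtains \<phi> where "\<phi> \<in> test_functions \<omega>" "\<And>x. x \<in> ball z r \<Longrightarrow> \<phi> x > 0" "\<And>x. x \<notin> ball z r \<Longrightarrow> \<phi> x = 0"
proof -
  define \<phi> where "\<phi> = (\<lambda>x. flat_fun 0 (r\<^sup>2 - (x - z) \<bullet> (x - z)))"
  have "r\<^sup>2 - (x - z) \<bullet> (x - z) > 0 \<longleftrightarrow> x \<in> ball z r" for x
    using assms(1) power_mono_iff[of r "norm (x - z)" 2] 
    by (auto simp: dot_square_norm dist_norm norm_minus_commute not_le[symmetric])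
  hence in_ball: "\<phi> x = (if x \<in> ball z r then exp (- inverse (r\<^sup>2 - (x - z) \<bullet> (x - z))) else 0)" for x
    by (simp add: \<phi>_def flat_fun_def)
  have "{x. \<phi> x \<noteq> 0} = ball z r" by (auto simp: in_ball)
  hence "closure {x. \<phi> x \<noteq> 0} = cball z r" using assms(1) by simp
  moreover have "smooth_fun \<phi>"
    unfolding \<phi>_def by (rule radial_algebra_smooth) (rule radial_algebra.flat)
  ultimately have "\<phi> \<in> test_functions \<omega>"
    using assms(2) unfolding test_functions_def by (simp only: mem_Collect_eq compact_cball simp_thms)
  thus ?thesis by (rule that) (simp_all add: in_ball)
qed

lemma test_function_continuous:
  assumes "\<phi> \<in> test_functions \<omega>"
  shows "continuous_on UNIV \<phi>"
proof -
  have "smooth_fun \<phi>" using assms by (simp add: test_functions_def)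
  hence "\<phi> differentiable (at x)" for x
    unfolding smooth_fun_def by (metis empty_set empty_subsetI iter_deriv.simps(1))
  thus ?thesis
    by (intro continuous_at_imp_continuous_on) (simp add: differentiable_imp_continuous_within)
qed

text \<open>Writing the pairing with the gradient as an inner product of square integrable functions puts
  the defining identity of the weak divergence into the bilinear calculus of \<open>L2_inner\<close>.\<close>

lemma test_function_gradient:
  fixes \<phi> :: "'a::euclidean_space \<Rightarrow> real"
  assumes "\<phi> \<in> test_functions \<omega>" "bounded \<omega>" "\<omega> \<in> sets lebesgue"
  shows "\<exists>G \<in> L2_space (lebesgue_on \<omega>). \<forall>x h. frechet_derivative \<phi> (at x) h = h \<bullet> G x"
proof -
  have sm: "smooth_fun \<phi>" using assms by (simp add: test_functions_def)
  define G where "G = (\<lambda>x. \<Sum>b\<in>Basis. frechet_derivative \<phi> (at x) b *\<^sub>R b)"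
  have diff: "\<phi> differentiable (at x)" for x
    using sm unfolding smooth_fun_def by (metis empty_set empty_subsetI iter_deriv.simps(1))
  have cont: "continuous_on UNIV (\<lambda>x. frechet_derivative \<phi> (at x) b)" if "b \<in> Basis" for b
  proof -
    have "iter_deriv [b] \<phi> differentiable (at x)" for x
      using sm that unfolding smooth_fun_def by (metis empty_set empty_subsetI insert_subset list.simps(15))
    hence "(\<lambda>x. frechet_derivative \<phi> (at x) b) differentiable (at x)" for x by simp
    thus ?thesis
      by (intro continuous_at_imp_continuous_on) (simp add: differentiable_imp_continuous_within)
  qed
  have "continuous_on UNIV G"
    unfolding G_def by (intro continuous_intros cont)
  hence G2: "G \<in> L2_space (lebesgue_on \<omega>)" using assms by (intro L2_space_continuous)
  have G: "frechet_derivative \<phi> (at x) h = h \<bullet> G x" for x h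
  proof -
    have lin: "linear (frechet_derivative \<phi> (at x))" using diff by (rule linear_frechet_derivative)
    have "frechet_derivative \<phi> (at x) (\<Sum>b\<in>Basis. (h \<bullet> b) *\<^sub>R b) = h \<bullet> G x"
      by (simp only: linear_sum[OF lin] linear_cmul[OF lin] G_def inner_sum_right inner_scaleR_right
          real_scaleR_def mult.commute)
    thus ?thesis by (simp add: euclidean_representation)
  qed
  show ?thesis using G2 G by blast
qed

section \<open>The weak divergence\<close>

lemma has_weak_div_lincomb:
  fixes v w :: "'a::euclidean_space \<Rightarrow> 'a"
  assumes \<omega>: "bounded \<omega>" "\<omega> \<in> sets lebesgue"
    and vw: "v \<in> L2_space (lebesgue_on \<omega>)" "w \<in> L2_space (lebesgue_on \<omega>)"
    and div: "has_weak_div \<omega> v q" "has_weak_div \<omega> w q'"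
  shows "has_weak_div \<omega> (\<lambda>x. v x + c *\<^sub>R w x) (\<lambda>x. q x + c *\<^sub>R q' x)"
proof -
  have q: "q \<in> L2_space (lebesgue_on \<omega>)" "q' \<in> L2_space (lebesgue_on \<omega>)"
    using div by (auto simp: has_weak_div_def)
  show ?thesis
    unfolding has_weak_div_def
  proof (intro conjI ballI)
    show "(\<lambda>x. q x + c *\<^sub>R q' x) \<in> L2_space (lebesgue_on \<omega>)" using q by (rule L2_lincomb)
    fix \<phi> assume \<phi>: "\<phi> \<in> test_functions \<omega>"
    obtain G where G: "G \<in> L2_space (lebesgue_on \<omega>)" "\<And>x h. frechet_derivative \<phi> (at x) h = h \<bullet> G x"
      using test_function_gradient[OF \<phi> \<omega>] by blast
    have \<phi>2: "\<phi> \<in> L2_space (lebesgue_on \<omega>)"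
      using \<omega> test_function_continuous[OF \<phi>] by (rule L2_space_continuous)
    have 1: "L2_inner (lebesgue_on \<omega>) v G = - L2_inner (lebesgue_on \<omega>) q \<phi>"
      "L2_inner (lebesgue_on \<omega>) w G = - L2_inner (lebesgue_on \<omega>) q' \<phi>"
      using div \<phi> by (auto simp: has_weak_div_def L2_inner_def G(2))
    have "L2_inner (lebesgue_on \<omega>) (\<lambda>x. v x + c *\<^sub>R w x) G
        = - L2_inner (lebesgue_on \<omega>) (\<lambda>x. q x + c *\<^sub>R q' x) \<phi>"
      unfolding L2_inner_lincomb_left[OF vw G(1)] L2_inner_lincomb_left[OF q \<phi>2] 1 by simp
    thus "(\<integral>x. frechet_derivative \<phi> (at x) (v x + c *\<^sub>R w x) \<partial>lebesgue_on \<omega>)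
        = - (\<integral>x. (q x + c *\<^sub>R q' x) * \<phi> x \<partial>lebesgue_on \<omega>)"
      by (simp add: L2_inner_def G(2))
  qed
qed

lemma has_weak_div_null:
  fixes v :: "'a::euclidean_space \<Rightarrow> 'a"
  assumes \<omega>: "bounded \<omega>" "\<omega> \<in> sets lebesgue" and v: "AE x in lebesgue_on \<omega>. v x = 0"
  shows "has_weak_div \<omega> v (\<lambda>x. 0)"
  unfolding has_weak_div_def
proof (intro conjI ballI L2_zero)
  fix \<phi> assume \<phi>: "\<phi> \<in> test_functions \<omega>"
  obtain G where "G \<in> L2_space (lebesgue_on \<omega>)" and G: "\<And>x h. frechet_derivative \<phi> (at x) h = h \<bullet> G x"
    using test_function_gradient[OF \<phi> \<omega>] by blast
  have "(\<integral>x. v x \<bullet> G x \<partial>lebesgue_on \<omega>) = 0"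
    using L2_inner_zero_AE[OF v, of G] by (simp add: L2_inner_def)
  thus "(\<integral>x. frechet_derivative \<phi> (at x) (v x) \<partial>lebesgue_on \<omega>)
        = - (\<integral>x. 0 * \<phi> x \<partial>lebesgue_on \<omega>)"
    by (simp add: G)
qed

text \<open>The fundamental lemma of the calculus of variations, for functions that are continuous on an
  open set: where \<open>p\<close> does not vanish it has constant sign on a small ball, and a bump function
  supported in that ball has a nonzero integral against it.\<close>

lemma continuous_orthogonal_test_functions_zero:
  fixes p :: "'a::euclidean_space \<Rightarrow> real"
  assumes \<omega>: "bounded \<omega>" "\<omega> \<in> sets lebesgue" and U: "open U" "U \<subseteq> \<omega>"
    and p: "continuous_on UNIV p" and d: "d \<in> L2_space (lebesgue_on \<omega>)"
    and eq: "AE x in lebesgue_on U. d x = p x"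
    and orth: "\<And>\<phi>. \<phi> \<in> test_functions \<omega> \<Longrightarrow> L2_inner (lebesgue_on \<omega>) d \<phi> = 0"
    and x: "x \<in> U"
  shows "p x = 0"
proof (rule ccontr)
  assume "p x \<noteq> 0"
  define s where "s = sgn (p x)"
  have s: "s * p x > 0" using \<open>p x \<noteq> 0\<close> by (simp add: s_def sgn_if)
  have "open (U \<inter> {y. s * p y > 0})"
    using U(1) p by (intro open_Int open_Collect_less continuous_intros) auto
  then obtain e where e: "e > 0" "ball x e \<subseteq> U \<inter> {y. s * p y > 0}"
    using x s open_contains_ball[of "U \<inter> {y. s * p y > 0}"] by blast
  have cb: "cball x (e/2) \<subseteq> ball x e" using e(1) by (auto simp: subset_iff)
  hence "cball x (e/2) \<subseteq> \<omega>" using e(2) U(2) by blast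
  with e(1) obtain \<phi> where \<phi>: "\<phi> \<in> test_functions \<omega>"
    "\<And>y. y \<in> ball x (e/2) \<Longrightarrow> \<phi> y > 0" "\<And>y. y \<notin> ball x (e/2) \<Longrightarrow> \<phi> y = 0"
    using exists_bump_function[of "e/2" x \<omega>] by auto
  have bs: "ball x (e/2) \<subseteq> U" "\<And>y. y \<in> ball x (e/2) \<Longrightarrow> s * p y > 0"
    using e(2) subset_trans[OF ball_subset_cball cb] by auto
  have \<phi>2: "\<phi> \<in> L2_space (lebesgue_on \<omega>)"
    using \<omega> test_function_continuous[OF \<phi>(1)] by (rule L2_space_continuous)
  have int: "integrable (lebesgue_on \<omega>) (\<lambda>y. s * (d y * \<phi> y))"
    using L2_inner_integrable[OF d \<phi>2] by simp
  have deq: "AE y in lebesgue_on \<omega>. y \<in> U \<longrightarrow> d y = p y"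
    using eq U \<omega>(2) by (auto simp: AE_restrict_space_iff elim!: eventually_mono)
  have nonneg: "AE y in lebesgue_on \<omega>. 0 \<le> s * (d y * \<phi> y)"
    using deq
  proof eventually_elim
    case (elim y)
    show ?case
    proof (cases "y \<in> ball x (e/2)")
      case True
      hence "0 < s * p y * \<phi> y" using bs \<phi>(2) by simp
      thus ?thesis using elim True bs(1) by (auto simp: mult.assoc)
    next
      case False
      thus ?thesis using \<phi>(3) by simp
    qed
  qed
  have "(\<integral>y. s * (d y * \<phi> y) \<partial>lebesgue_on \<omega>) = s * L2_inner (lebesgue_on \<omega>) d \<phi>"
    by (simp add: L2_inner_def)
  also have "\<dots> = 0" using orth[OF \<phi>(1)] by simp
  finally have "AE y in lebesgue_on \<omega>. s * (d y * \<phi> y) = 0"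
    using integral_nonneg_eq_0_iff_AE[OF int nonneg] by simp
  with deq have "AE y in lebesgue_on \<omega>. y \<notin> ball x (e/2)"
  proof eventually_elim
    case (elim y)
    show ?case
    proof
      assume y: "y \<in> ball x (e/2)"
      hence "0 < s * p y * \<phi> y" using bs \<phi>(2) by simp
      thus False using elim y bs(1) by (auto simp: mult.assoc)
    qed
  qed
  hence "AE y in lebesgue. y \<notin> ball x (e/2)"
    using \<omega>(2) bs(1) U(2) by (auto simp: AE_restrict_space_iff elim!: eventually_mono)
  hence "negligible (ball x (e/2))"
    by (simp add: AE_iff_null_sets negligible_iff_null_sets)
  thus False using open_not_negligible[of "ball x (e/2)"] e(1) by simp
qed

section \<open>Piecewise polynomials\<close>

text \<open>No measurability is required, so that this is a subspace of the space of all functions and the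
  representatives in the next lemmas can be cut off along arbitrary sets.\<close>

definition null_funs :: "'a::euclidean_space set \<Rightarrow> ('a \<Rightarrow> 'b::real_vector) set" where
  "null_funs \<omega> = {f. AE x in lebesgue_on \<omega>. f x = 0}"

lemma subspace_null_funs: "subspace (null_funs \<omega>)"
  unfolding linear_space_iff_subspace[symmetric] linear_space_def null_funs_def by auto

definition piecewise :: "'a::euclidean_space set set \<Rightarrow> ('a \<Rightarrow> 'b) set \<Rightarrow> ('a \<Rightarrow> 'b) \<Rightarrow> bool" where
  "piecewise \<T> P v \<longleftrightarrow> (\<forall>T\<in>\<T>. \<exists>p\<in>P. AE x in lebesgue_on T. v x = p x)"

lemma piecewise_lincomb:
  assumes "linear_space P" "piecewise \<T> P v" "piecewise \<T> P w"
  shows "piecewise \<T> P (\<lambda>x. v x + c *\<^sub>R w x)"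
  unfolding piecewise_def
proof
  fix T assume "T \<in> \<T>"
  then obtain p q where *: "p \<in> P" "q \<in> P" "AE x in lebesgue_on T. v x = p x" "AE x in lebesgue_on T. w x = q x"
    using assms(2,3) unfolding piecewise_def by blast
  have 1: "(\<lambda>x. p x + c *\<^sub>R q x) \<in> P" using assms(1) *(1,2) unfolding linear_space_def by blast
  show "\<exists>p\<in>P. AE x in lebesgue_on T. v x + c *\<^sub>R w x = p x"
  proof (rule bexI[OF _ 1])
    show "AE x in lebesgue_on T. v x + c *\<^sub>R w x = p x + c *\<^sub>R q x"
      using *(3,4) by eventually_elim simp
  qed
qed

lemma polys_finite_span:
  "\<exists>C :: ('a::euclidean_space \<Rightarrow> 'b::euclidean_space) set. finite C \<and> polys m \<subseteq> span C"
proof -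
  define A :: "('a \<Rightarrow> nat) set" where "A = {\<alpha> \<in> Basis \<rightarrow>\<^sub>E {..m}. sum \<alpha> Basis \<le> m}"
  have "finite (Basis \<rightarrow>\<^sub>E {..m} :: ('a \<Rightarrow> nat) set)" by (rule finite_PiE) auto
  hence finA: "finite A" by (rule finite_subset[rotated]) (auto simp: A_def)
  define e :: "('a \<Rightarrow> nat) \<Rightarrow> 'b \<Rightarrow> 'a \<Rightarrow> 'b"
    where "e \<alpha> b = (\<lambda>x. (\<Prod>i\<in>Basis. (x \<bullet> i) ^ \<alpha> i) *\<^sub>R b)" for \<alpha> b
  define C where "C = (\<lambda>(\<alpha>, b). e \<alpha> b) ` (A \<times> Basis)"
  have "p \<in> span C" if p: "p \<in> polys m" for p :: "'a \<Rightarrow> 'b"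
  proof -
    from p obtain c where c: "p = (\<lambda>x. \<Sum>\<alpha>\<in>A. (\<Prod>i\<in>Basis. (x \<bullet> i) ^ \<alpha> i) *\<^sub>R c \<alpha>)"
      unfolding polys_def A_def by blast
    have "p = (\<Sum>\<alpha>\<in>A. \<Sum>b\<in>Basis. (c \<alpha> \<bullet> b) *\<^sub>R e \<alpha> b)"
    proof
      fix x
      have "(\<Sum>b\<in>Basis. (c \<alpha> \<bullet> b) *\<^sub>R e \<alpha> b) x = (\<Prod>i\<in>Basis. (x \<bullet> i) ^ \<alpha> i) *\<^sub>R c \<alpha>" for \<alpha>
      proof -
        have "(\<Sum>b\<in>Basis. (c \<alpha> \<bullet> b) *\<^sub>R e \<alpha> b) x
            = (\<Prod>i\<in>Basis. (x \<bullet> i) ^ \<alpha> i) *\<^sub>R (\<Sum>b\<in>Basis. (c \<alpha> \<bullet> b) *\<^sub>R b)"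
          by (simp add: sum_fun_apply e_def scaleR_sum_right mult.commute)
        thus ?thesis by (simp add: euclidean_representation)
      qed
      thus "p x = (\<Sum>\<alpha>\<in>A. \<Sum>b\<in>Basis. (c \<alpha> \<bullet> b) *\<^sub>R e \<alpha> b) x"
        unfolding c by (simp only: sum_fun_apply[of _ A])
    qed
    also have "\<dots> \<in> span C"
      by (intro span_sum span_scale span_base) (auto simp: C_def)
    finally show ?thesis .
  qed
  moreover have "finite C" using finA by (simp add: C_def)
  ultimately show ?thesis by blast
qed

lemma continuous_polys:
  assumes "p \<in> polys m"
  shows "continuous_on A p"
proof -
  obtain c where "p = (\<lambda>x. \<Sum>\<alpha> \<in> {\<alpha> \<in> Basis \<rightarrow>\<^sub>E {..m}. sum \<alpha> Basis \<le> m}.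
                (\<Prod>b\<in>Basis. (x \<bullet> b) ^ \<alpha> b) *\<^sub>R c \<alpha>)"
    using assms unfolding polys_def by blast
  thus ?thesis by (simp only:) (intro continuous_intros)
qed

lemma constant_in_polys: "(\<lambda>x. c) \<in> polys m"
proof -
  define \<alpha>0 :: "'a \<Rightarrow> nat" where "\<alpha>0 = (\<lambda>b\<in>Basis. 0)"
  define A :: "('a \<Rightarrow> nat) set" where "A = {\<alpha> \<in> Basis \<rightarrow>\<^sub>E {..m}. sum \<alpha> Basis \<le> m}"
  have "finite (Basis \<rightarrow>\<^sub>E {..m} :: ('a \<Rightarrow> nat) set)" by (rule finite_PiE) auto
  hence finA: "finite A" by (rule finite_subset[rotated]) (auto simp: A_def)
  have \<alpha>0: "\<alpha>0 \<in> A" by (auto simp: A_def \<alpha>0_def)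
  have "(\<Sum>\<alpha>\<in>A. (\<Prod>b\<in>Basis. (x \<bullet> b) ^ \<alpha> b) *\<^sub>R (if \<alpha> = \<alpha>0 then c else 0)) = c" for x :: 'a
  proof -
    have "(\<Sum>\<alpha>\<in>A. (\<Prod>b\<in>Basis. (x \<bullet> b) ^ \<alpha> b) *\<^sub>R (if \<alpha> = \<alpha>0 then c else 0))
        = (\<Prod>b\<in>Basis. (x \<bullet> b) ^ \<alpha>0 b) *\<^sub>R c"
      using finA \<alpha>0 by (subst sum.remove[OF finA \<alpha>0]) (auto intro!: sum.neutral)
    also have "(\<Prod>b\<in>Basis. (x \<bullet> b) ^ \<alpha>0 b) = 1" by (simp add: \<alpha>0_def)
    finally show ?thesis by simp
  qed
  thus ?thesis unfolding polys_def A_def[symmetric]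
    by (intro CollectI exI[of _ "\<lambda>\<alpha>. if \<alpha> = \<alpha>0 then c else 0"]) simp
qed

text \<open>A piecewise polynomial agrees almost everywhere with a sum of cell polynomials, each cut off to
  the points whose selected cell is the given one. Selecting one cell for each point makes the pieces
  disjoint even where cells overlap on their boundaries.\<close>

lemma piecewise_finite_dim:
  fixes P :: "('a::euclidean_space \<Rightarrow> 'b::euclidean_space) set"
  assumes \<T>: "finite \<T>" "\<And>T. T \<in> \<T> \<Longrightarrow> T \<in> sets lebesgue" and \<omega>: "\<omega> \<in> sets lebesgue" "\<omega> \<subseteq> \<Union>\<T>"
    and P: "P \<subseteq> polys m"
  shows "\<exists>B. finite B \<and> (\<forall>v. piecewise \<T> P v \<longrightarrow> (\<exists>b\<in>span B. v - b \<in> null_funs \<omega>))"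
proof -
  obtain C :: "('a \<Rightarrow> 'b) set" where C: "finite C" "polys m \<subseteq> span C"
    using polys_finite_span by blast
  define s where "s x = (SOME T. T \<in> \<T> \<and> x \<in> T)" for x
  have s: "s x \<in> \<T> \<and> x \<in> s x" if "x \<in> \<omega>" for x
  proof -
    have "\<exists>T. T \<in> \<T> \<and> x \<in> T" using that \<omega>(2) by blast
    thus ?thesis unfolding s_def by (rule someI_ex)
  qed
  define R where "R T f = (\<lambda>x. if s x = T then f x else 0)" for T and f :: "'a \<Rightarrow> 'b"
  have linR: "linear (R T)" for T
    by (rule linearI) (auto simp: R_def fun_eq_iff)
  define B where "B = (\<Union>T\<in>\<T>. R T ` C)"
  have "\<exists>b\<in>span B. v - b \<in> null_funs \<omega>" if v: "piecewise \<T> P v" for v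
  proof -
    have "\<forall>T\<in>\<T>. \<exists>p. p \<in> P \<and> (AE x in lebesgue_on T. v x = p x)"
      using v unfolding piecewise_def by blast
    from bchoice[OF this] obtain p where
      p: "\<And>T. T \<in> \<T> \<Longrightarrow> p T \<in> P" "\<And>T. T \<in> \<T> \<Longrightarrow> AE x in lebesgue_on T. v x = p T x"
      by blast
    define b where "b = (\<Sum>T\<in>\<T>. R T (p T))"
    have "R T (p T) \<in> span B" if T: "T \<in> \<T>" for T
    proof -
      have "p T \<in> span C" using p(1)[OF T] P C(2) by blast
      hence "R T (p T) \<in> span (R T ` C)" unfolding linear_span_image[OF linR] by blast
      moreover have "span (R T ` C) \<subseteq> span B" using T by (intro span_mono) (auto simp: B_def)
      ultimately show ?thesis by blast
    qed
    hence "b \<in> span B" unfolding b_def by (rule span_sum)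
    moreover have "v - b \<in> null_funs \<omega>"
    proof -
      have "AE x in lebesgue. \<forall>T\<in>\<T>. x \<in> T \<longrightarrow> v x = p T x"
        using p(2) \<T> by (intro AE_finite_allI) (auto simp: AE_restrict_space_iff)
      hence "AE x in lebesgue. x \<in> \<omega> \<longrightarrow> (v - b) x = 0"
      proof eventually_elim
        case (elim x)
        show ?case
        proof
          assume x: "x \<in> \<omega>"
          have "b x = (\<Sum>T\<in>\<T>. if T = s x then p T x else 0)"
            unfolding b_def sum_fun_apply R_def by (intro sum.cong) auto
          also have "\<dots> = p (s x) x" using s[OF x] \<T>(1) by simp
          finally show "(v - b) x = 0" using elim s[OF x] by simp
        qed
      qed
      thus ?thesis using \<omega>(1) by (simp add: null_funs_def AE_restrict_space_iff)
    qed
    ultimately show ?thesis by blast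
  qed
  moreover have "finite B" using \<T>(1) C(1) by (simp add: B_def)
  ultimately show ?thesis by blast
qed

lemma continuous_AE_eq_closure:
  fixes p q :: "'a::euclidean_space \<Rightarrow> 'b::real_normed_vector"
  assumes "open U" "continuous_on UNIV p" "continuous_on UNIV q"
    and "AE x in lebesgue_on U. p x = q x" and "x \<in> closure U"
  shows "p x = q x"
proof -
  have "open (U \<inter> {y. p y \<noteq> q y})"
    using assms(1-3) by (intro open_Int open_Collect_neq)
  moreover have "negligible (U \<inter> {y. p y \<noteq> q y})"
  proof -
    have "AE y in lebesgue. y \<notin> U \<inter> {y. p y \<noteq> q y}"
      using assms(1,4) by (auto simp: AE_restrict_space_iff elim!: eventually_mono)
    hence "U \<inter> {y. p y \<noteq> q y} \<in> null_sets lebesgue"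
      using \<open>open (U \<inter> {y. p y \<noteq> q y})\<close> by (subst AE_iff_null_sets) auto
    thus ?thesis by (simp add: negligible_iff_null_sets)
  qed
  ultimately have "U \<inter> {y. p y \<noteq> q y} = {}" using open_not_negligible by blast
  hence "U \<subseteq> {y. p y = q y}" by blast
  moreover have "closed {y. p y = q y}" using assms(2,3) by (intro closed_Collect_eq)
  ultimately show ?thesis using assms(5) closure_minimal by blast
qed

section \<open>The discrete spaces\<close>

text \<open>The properties of one member of the family of discretisations that enter the argument.\<close>

locale cut_discretisation =
  fixes S :: "'a::euclidean_space setting" and D :: "'a discretisation"
  assumes open_Omega: "open (Omega S)" and Omega_nonempty: "Omega S \<noteq> {}"
    and mesh: "conforming_mesh (background D) (bg_mesh D)" "Omega S \<subseteq> background D"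
    and poly_d: "polynomial_local_space (poly_d S)"
    and poly_0: "polynomial_local_space (poly_0 S)"
    and constants: "\<exists>k. contains_polys (active_cells S D) k (poly_0 S)"
    and Gamma_u: "Gamma_u S \<in> sets borel" "Gamma_u S \<subseteq> frontier (Omega S)"
    and surface: "emeasure surface_measure (frontier (Omega S)) < \<infinity>"
    and normal: "normal S \<in> borel_measurable (surface_on (frontier (Omega S)))"
      "AE x in surface_on (frontier (Omega S)). norm (normal S x) = 1"
    and Div_V0: "\<And>v. v \<in> V_d S D \<Longrightarrow> Div S D v \<in> V_0 S D"
    and stab_d: "bilinear_on (Omega_h S D) (V_d S D) (stab_d D)"
    and stab_0: "bilinear_on (Omega_h S D) (V_0 S D) (stab_0 D)"
    and stab_0_const: "\<And>c q. q \<in> V_0 S D \<Longrightarrow> stab_0 D (\<lambda>x. c) q = 0"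
begin

abbreviation "\<Omega> \<equiv> Omega S"
abbreviation "\<Omega>h \<equiv> Omega_h S D"
abbreviation "cells \<equiv> active_cells S D"

lemma finite_cells: "finite cells"
  using mesh(1) by (simp add: active_cells_def conforming_mesh_def)

lemma cell_polytope: "T \<in> cells \<Longrightarrow> polytope T"
  using mesh(1) by (auto simp: active_cells_def conforming_mesh_def)

lemma cell_closed: "T \<in> cells \<Longrightarrow> closed T"
  using cell_polytope polytope_imp_closed by blast

lemma cell_measurable: "T \<in> cells \<Longrightarrow> T \<in> sets lebesgue"
  using cell_closed by (auto intro: borel_closed)

lemma closed_cells: "closed (\<Union>cells)"
  using finite_cells cell_closed by (intro closed_Union) auto

lemma bounded_cells: "bounded (\<Union>cells)"
  using finite_cells cell_polytope polytope_imp_bounded by (intro bounded_Union) auto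

lemma Omega_h_eq: "\<Omega>h = interior (\<Union>cells)"
  using closed_cells by (simp add: Omega_h_def closure_closed)

lemma Omega_h_subset: "\<Omega>h \<subseteq> \<Union>cells"
  unfolding Omega_h_eq by (rule interior_subset)

lemma open_Omega_h: "open \<Omega>h" by (simp add: Omega_h_eq)

lemma Omega_h_measurable: "\<Omega>h \<in> sets lebesgue"
  using open_Omega_h by simp

lemma Omega_measurable: "\<Omega> \<in> sets lebesgue"
  using open_Omega by simp

lemma bounded_Omega_h: "bounded \<Omega>h"
  using bounded_cells Omega_h_subset by (rule bounded_subset)

lemma Omega_subset: "\<Omega> \<subseteq> \<Omega>h"
proof -
  have "\<Omega> \<subseteq> \<Union>cells"
  proof
    fix x assume x: "x \<in> \<Omega>"
    hence "x \<in> closure (background D)" using mesh(2) closure_subset by blast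
    then obtain T where "T \<in> bg_mesh D" "x \<in> T"
      using mesh(1) unfolding conforming_mesh_def by blast
    thus "x \<in> \<Union>cells" using x by (auto simp: active_cells_def)
  qed
  thus ?thesis unfolding Omega_h_eq using open_Omega by (rule interior_maximal)
qed

lemma bounded_Omega: "bounded \<Omega>"
  using bounded_Omega_h Omega_subset by (rule bounded_subset)

lemma interior_cell_subset: "T \<in> cells \<Longrightarrow> interior T \<subseteq> \<Omega>h"
  unfolding Omega_h_eq by (intro interior_mono) auto

lemma V_d_iff: "v \<in> V_d S D \<longleftrightarrow> v \<in> Hdiv \<Omega>h \<and> piecewise cells (poly_d S) v"
  by (simp add: V_d_def piecewise_def)

lemma V_0_iff: "q \<in> V_0 S D \<longleftrightarrow> q \<in> L2_space (lebesgue_on \<Omega>h) \<and> piecewise cells (poly_0 S) q"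
  by (simp add: V_0_def piecewise_def)

lemma V_d_L2: "v \<in> V_d S D \<Longrightarrow> v \<in> L2_space (lebesgue_on \<Omega>h)"
  by (simp add: V_d_def Hdiv_def)

lemma V_0_L2: "q \<in> V_0 S D \<Longrightarrow> q \<in> L2_space (lebesgue_on \<Omega>h)"
  by (simp add: V_0_def)

lemma V_d_L2_Omega: "v \<in> V_d S D \<Longrightarrow> v \<in> L2_space (lebesgue_on \<Omega>)"
  by (rule L2_space_subset[OF Omega_h_measurable Omega_measurable Omega_subset V_d_L2])

lemma V_0_L2_Omega: "q \<in> V_0 S D \<Longrightarrow> q \<in> L2_space (lebesgue_on \<Omega>)"
  by (rule L2_space_subset[OF Omega_h_measurable Omega_measurable Omega_subset V_0_L2])

lemma has_weak_div_Div:
  assumes "v \<in> V_d S D"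
  shows "has_weak_div \<Omega>h v (Div S D v)"
proof -
  have "\<exists>q. has_weak_div \<Omega>h v q" using assms by (simp add: V_d_def Hdiv_def)
  thus ?thesis unfolding weak_div_def by (rule someI_ex)
qed

lemma zero_in_poly: "(\<lambda>x. 0) \<in> poly_d S" "(\<lambda>x. 0) \<in> poly_0 S"
  using poly_d poly_0 by (auto simp: polynomial_local_space_def linear_space_def)

lemma V_d_lincomb:
  assumes "v \<in> V_d S D" "w \<in> V_d S D"
  shows "(\<lambda>x. v x + c *\<^sub>R w x) \<in> V_d S D"
proof -
  have "has_weak_div \<Omega>h (\<lambda>x. v x + c *\<^sub>R w x) (\<lambda>x. Div S D v x + c *\<^sub>R Div S D w x)"
    using assms by (intro has_weak_div_lincomb bounded_Omega_h Omega_h_measurable V_d_L2 has_weak_div_Div)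
  moreover have "(\<lambda>x. v x + c *\<^sub>R w x) \<in> L2_space (lebesgue_on \<Omega>h)"
    using assms by (intro L2_lincomb V_d_L2)
  moreover have "piecewise cells (poly_d S) (\<lambda>x. v x + c *\<^sub>R w x)"
    using assms poly_d by (intro piecewise_lincomb) (auto simp: V_d_iff polynomial_local_space_def)
  ultimately show ?thesis by (auto simp: V_d_iff Hdiv_def)
qed

lemma V_0_lincomb:
  assumes "v \<in> V_0 S D" "w \<in> V_0 S D"
  shows "(\<lambda>x. v x + c *\<^sub>R w x) \<in> V_0 S D"
proof -
  have "(\<lambda>x. v x + c *\<^sub>R w x) \<in> L2_space (lebesgue_on \<Omega>h)"
    using assms by (intro L2_lincomb V_0_L2)
  moreover have "piecewise cells (poly_0 S) (\<lambda>x. v x + c *\<^sub>R w x)"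
    using assms poly_0 by (intro piecewise_lincomb) (auto simp: V_0_iff polynomial_local_space_def)
  ultimately show ?thesis by (auto simp: V_0_iff)
qed

lemma subspace_V_d: "subspace (V_d S D)"
proof -
  have "has_weak_div \<Omega>h (\<lambda>x. 0) (\<lambda>x. 0)"
    by (rule has_weak_div_null) (simp_all add: bounded_Omega_h Omega_h_measurable)
  hence "(\<lambda>x. 0) \<in> V_d S D"
    using zero_in_poly(1) by (auto simp: V_d_def Hdiv_def L2_zero)
  thus ?thesis
    unfolding linear_space_iff_subspace[symmetric] linear_space_def using V_d_lincomb by blast
qed

lemma subspace_V_0: "subspace (V_0 S D)"
proof -
  have "(\<lambda>x. 0) \<in> V_0 S D"
    using zero_in_poly(2) by (auto simp: V_0_def L2_zero)
  thus ?thesis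
    unfolding linear_space_iff_subspace[symmetric] linear_space_def using V_0_lincomb by blast
qed

lemma constant_in_V_0: "(\<lambda>x. c) \<in> V_0 S D"
proof -
  have "\<exists>p\<in>poly_0 S. AE x in lebesgue_on T. c = p x" if T: "T \<in> cells" for T
  proof -
    obtain k where "\<forall>p\<in>polys k. \<exists>q\<in>poly_0 S. \<forall>x\<in>T. p x = q x"
      using constants T by (auto simp: contains_polys_def)
    from bspec[OF this constant_in_polys[of c k]]
    obtain p where p: "p \<in> poly_0 S" "\<And>x. x \<in> T \<Longrightarrow> c = p x"
      by auto
    have "AE x in lebesgue_on T. c = p x"
      using p(2) by (intro AE_I2) (simp add: space_restrict_space)
    thus ?thesis using p(1) by blast
  qed
  moreover have "(\<lambda>x. c) \<in> L2_space (lebesgue_on \<Omega>h)"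
    by (intro L2_space_continuous bounded_Omega_h Omega_h_measurable continuous_on_const)
  ultimately show ?thesis by (simp add: V_0_def)
qed

lemma poly_d_polys: "\<exists>m. poly_d S \<subseteq> polys m" and poly_0_polys: "\<exists>m. poly_0 S \<subseteq> polys m"
  using poly_d poly_0 by (auto simp: polynomial_local_space_def)

lemma V_d_finite_dim:
  "\<exists>B. finite B \<and> (\<forall>v\<in>V_d S D. \<exists>b\<in>span B. v - b \<in> null_funs \<Omega>h)"
proof -
  obtain m where "poly_d S \<subseteq> polys m" using poly_d_polys by blast
  from piecewise_finite_dim[OF finite_cells cell_measurable Omega_h_measurable Omega_h_subset this]
  obtain B where "finite B" "\<And>v. piecewise cells (poly_d S) v \<Longrightarrow> \<exists>b\<in>span B. v - b \<in> null_funs \<Omega>h"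
    by auto
  thus ?thesis by (intro exI[of _ B] conjI ballI) (simp_all only: V_d_iff)
qed

lemma V_0_finite_dim:
  "\<exists>B. finite B \<and> (\<forall>v\<in>V_0 S D. \<exists>b\<in>span B. v - b \<in> null_funs \<Omega>h)"
proof -
  obtain m where "poly_0 S \<subseteq> polys m" using poly_0_polys by blast
  from piecewise_finite_dim[OF finite_cells cell_measurable Omega_h_measurable Omega_h_subset this]
  obtain B where "finite B" "\<And>v. piecewise cells (poly_0 S) v \<Longrightarrow> \<exists>b\<in>span B. v - b \<in> null_funs \<Omega>h"
    by auto
  thus ?thesis by (intro exI[of _ B] conjI ballI) (simp_all only: V_0_iff)
qed

lemma cell_boundary_null: "T \<in> cells \<Longrightarrow> AE x in lebesgue. x \<in> T \<longrightarrow> x \<in> interior T"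
proof -
  assume T: "T \<in> cells"
  have "negligible (frontier T)"
    using cell_polytope[OF T] polytope_imp_convex negligible_convex_frontier by blast
  hence "AE x in lebesgue. x \<notin> frontier T"
    by (simp add: AE_iff_null_sets negligible_iff_null_sets)
  thus ?thesis
    by eventually_elim (use closure_subset[of T] in \<open>auto simp: frontier_def\<close>)
qed

lemma AE_Omega_h_if_AE_cells:
  assumes "\<And>T. T \<in> cells \<Longrightarrow> \<forall>x\<in>interior T. p T x = 0"
    and "\<And>T. T \<in> cells \<Longrightarrow> AE x in lebesgue_on T. d x = p T x"
  shows "AE x in lebesgue_on \<Omega>h. d x = 0"
proof -
  have "AE x in lebesgue. x \<in> T \<longrightarrow> d x = 0" if T: "T \<in> cells" for T
  proof -
    have "AE x in lebesgue. x \<in> T \<longrightarrow> d x = p T x"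
      using assms(2)[OF T] cell_measurable[OF T] by (simp add: AE_restrict_space_iff)
    with cell_boundary_null[OF T] show ?thesis
      by eventually_elim (use assms(1)[OF T] in auto)
  qed
  hence "AE x in lebesgue. \<forall>T\<in>cells. x \<in> T \<longrightarrow> d x = 0"
    by (rule AE_finite_allI[OF finite_cells])
  thus ?thesis
    using Omega_h_measurable Omega_h_subset by (auto simp: AE_restrict_space_iff elim!: eventually_mono)
qed

lemma AE_interior_cell:
  assumes "T \<in> cells" "AE x in lebesgue_on T. P x"
  shows "AE x in lebesgue_on (interior T). P x"
  using assms by (intro AE_lebesgue_on_subset[OF cell_measurable _ interior_subset]) auto

text \<open>In the interior of a cell the difference of the two divergences is a polynomial orthogonal to
  all bump functions, hence zero; the cell boundaries are null sets because cells are convex.\<close>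

lemma weak_div_unique:
  assumes q: "q \<in> V_0 S D" "q' \<in> V_0 S D" and div: "has_weak_div \<Omega>h v q" "has_weak_div \<Omega>h v q'"
  shows "ae_eq \<Omega>h q q'"
proof -
  define d where "d = (\<lambda>x. q x + (-1) *\<^sub>R q' x)"
  have d: "d \<in> V_0 S D" unfolding d_def using q by (rule V_0_lincomb)
  have orth: "L2_inner (lebesgue_on \<Omega>h) d \<phi> = 0" if \<phi>: "\<phi> \<in> test_functions \<Omega>h" for \<phi>
  proof -
    have \<phi>2: "\<phi> \<in> L2_space (lebesgue_on \<Omega>h)"
      by (intro L2_space_continuous bounded_Omega_h Omega_h_measurable test_function_continuous[OF \<phi>])
    have "L2_inner (lebesgue_on \<Omega>h) q \<phi> = L2_inner (lebesgue_on \<Omega>h) q' \<phi>"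
      using div \<phi> by (simp add: has_weak_div_def L2_inner_def)
    thus ?thesis unfolding d_def L2_inner_lincomb_left[OF V_0_L2[OF q(1)] V_0_L2[OF q(2)] \<phi>2] by simp
  qed
  have "\<forall>T\<in>cells. \<exists>p. p \<in> poly_0 S \<and> (AE x in lebesgue_on T. d x = p x)"
    using d unfolding V_0_iff piecewise_def by blast
  from bchoice[OF this] obtain p where
    p: "\<And>T. T \<in> cells \<Longrightarrow> p T \<in> poly_0 S" "\<And>T. T \<in> cells \<Longrightarrow> AE x in lebesgue_on T. d x = p T x"
    by blast
  have "p T x = 0" if T: "T \<in> cells" and x: "x \<in> interior T" for T x
  proof (rule continuous_orthogonal_test_functions_zero[OF bounded_Omega_h Omega_h_measurable
      open_interior interior_cell_subset[OF T] _ V_0_L2[OF d] _ orth x])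
    show "continuous_on UNIV (p T)"
      using p(1)[OF T] poly_0_polys continuous_polys by blast
    show "AE x in lebesgue_on (interior T). d x = p T x" using T p(2)[OF T] by (rule AE_interior_cell)
  qed
  hence "AE x in lebesgue_on \<Omega>h. d x = 0" using p(2) by (intro AE_Omega_h_if_AE_cells[of p]) auto
  thus ?thesis by eventually_elim (simp add: d_def)
qed

lemma Div_lincomb:
  assumes "v \<in> V_d S D" "w \<in> V_d S D"
  shows "ae_eq \<Omega>h (Div S D (\<lambda>x. v x + c *\<^sub>R w x)) (\<lambda>x. Div S D v x + c *\<^sub>R Div S D w x)"
proof (rule weak_div_unique)
  show "has_weak_div \<Omega>h (\<lambda>x. v x + c *\<^sub>R w x) (\<lambda>x. Div S D v x + c *\<^sub>R Div S D w x)"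
    using assms by (intro has_weak_div_lincomb bounded_Omega_h Omega_h_measurable V_d_L2 has_weak_div_Div)
  show "Div S D (\<lambda>x. v x + c *\<^sub>R w x) \<in> V_0 S D" by (rule Div_V0[OF V_d_lincomb[OF assms]])
  show "(\<lambda>x. Div S D v x + c *\<^sub>R Div S D w x) \<in> V_0 S D"
    by (rule V_0_lincomb[OF Div_V0[OF assms(1)] Div_V0[OF assms(2)]])
  show "has_weak_div \<Omega>h (\<lambda>x. v x + c *\<^sub>R w x) (Div S D (\<lambda>x. v x + c *\<^sub>R w x))"
    by (rule has_weak_div_Div[OF V_d_lincomb[OF assms]])
qed

lemma Div_null:
  assumes "v \<in> V_d S D" "v \<in> null_funs \<Omega>h"
  shows "Div S D v \<in> null_funs \<Omega>h"
proof -
  have "ae_eq \<Omega>h (Div S D v) (\<lambda>x. 0)"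
    using assms by ((intro weak_div_unique[of _ _ v] Div_V0 constant_in_V_0 has_weak_div_Div
        has_weak_div_null bounded_Omega_h Omega_h_measurable), (auto simp: null_funs_def))
  thus ?thesis by (simp add: null_funs_def)
qed

section \<open>Boundary traces\<close>

lemma cell_poly:
  assumes "piecewise cells P v" "T \<in> cells"
  shows "cell_poly P T v \<in> P" "AE x in lebesgue_on T. v x = cell_poly P T v x"
proof -
  have "\<exists>p. p \<in> P \<and> (AE x in lebesgue_on T. v x = p x)"
    using assms unfolding piecewise_def by blast
  from someI_ex[OF this] show "cell_poly P T v \<in> P" "AE x in lebesgue_on T. v x = cell_poly P T v x"
    by (auto simp: cell_poly_def)
qed

lemma cell_poly_continuous:
  assumes "P \<subseteq> polys m" "piecewise cells P v" "T \<in> cells"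
  shows "continuous_on A (cell_poly P T v)"
  using cell_poly(1)[OF assms(2,3)] assms(1) continuous_polys by blast

text \<open>The chosen cell polynomials are unique only on the closure of the interior of the cell, by
  continuity. This suffices, since traces evaluate them only there; so traces are linear at every
  boundary point and not merely almost everywhere.\<close>

lemma cell_poly_lincomb:
  assumes P: "P \<subseteq> polys m" "linear_space P" and vw: "piecewise cells P v" "piecewise cells P w"
    and T: "T \<in> cells" and x: "x \<in> closure (interior T)"
  shows "cell_poly P T (\<lambda>x. v x + c *\<^sub>R w x) x = cell_poly P T v x + c *\<^sub>R cell_poly P T w x"
proof (rule continuous_AE_eq_closure[OF open_interior _ _ _ x,
      where q = "\<lambda>x. cell_poly P T v x + c *\<^sub>R cell_poly P T w x"])
  note pw = piecewise_lincomb[OF P(2) vw, of c]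
  show "continuous_on UNIV (cell_poly P T (\<lambda>x. v x + c *\<^sub>R w x))"
    using P(1) pw T by (rule cell_poly_continuous)
  show "continuous_on UNIV (\<lambda>x. cell_poly P T v x + c *\<^sub>R cell_poly P T w x)"
    using P(1) vw T by (intro continuous_intros cell_poly_continuous)
  have "AE x in lebesgue_on T. cell_poly P T (\<lambda>x. v x + c *\<^sub>R w x) x
        = cell_poly P T v x + c *\<^sub>R cell_poly P T w x"
    using cell_poly(2)[OF vw(1) T] cell_poly(2)[OF vw(2) T] cell_poly(2)[OF pw T]
    by eventually_elim simp
  with T show "AE x in lebesgue_on (interior T). cell_poly P T (\<lambda>x. v x + c *\<^sub>R w x) x
        = cell_poly P T v x + c *\<^sub>R cell_poly P T w x"
    by (rule AE_interior_cell)
qed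

lemma cell_poly_null:
  assumes P: "P \<subseteq> polys m" and v: "piecewise cells P v" "v \<in> null_funs \<Omega>h"
    and T: "T \<in> cells" and x: "x \<in> closure (interior T)"
  shows "cell_poly P T v x = 0"
proof (rule continuous_AE_eq_closure[OF open_interior _ _ _ x, where q = "\<lambda>_. 0"])
  show "continuous_on UNIV (cell_poly P T v)"
    using P v(1) T by (rule cell_poly_continuous)
  have "AE x in lebesgue_on \<Omega>h. v x = 0" using v(2) by (simp add: null_funs_def)
  hence "AE x in lebesgue_on (interior T). v x = 0"
    by (rule AE_lebesgue_on_subset[OF Omega_h_measurable _ interior_cell_subset[OF T], rotated]) simp
  with AE_interior_cell[OF T cell_poly(2)[OF v(1) T]]
  show "AE x in lebesgue_on (interior T). cell_poly P T v x = 0"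
    by eventually_elim (rule trans[OF sym])
qed (rule continuous_on_const)

lemma adjacent_closure_interior: "x \<in> closure (interior T \<inter> \<Omega>) \<Longrightarrow> x \<in> closure (interior T)"
  using closure_mono[of "interior T \<inter> \<Omega>" "interior T"] by auto

lemma bdry_trace_lincomb:
  assumes P: "polynomial_local_space P" and vw: "piecewise cells P v" "piecewise cells P w"
  shows "bdry_trace S D P (\<lambda>x. v x + c *\<^sub>R w x) x = bdry_trace S D P v x + c *\<^sub>R bdry_trace S D P w x"
proof -
  obtain m where m: "P \<subseteq> polys m" and lin: "linear_space P"
    using P by (auto simp: polynomial_local_space_def)
  have "cell_poly P T (\<lambda>x. v x + c *\<^sub>R w x) x = cell_poly P T v x + c *\<^sub>R cell_poly P T w x"
    if "T \<in> {T \<in> cells. x \<in> closure (interior T \<inter> \<Omega>)}" for T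
    using that by (intro cell_poly_lincomb[OF m lin vw] adjacent_closure_interior) auto
  hence "(\<Sum>T | T \<in> cells \<and> x \<in> closure (interior T \<inter> \<Omega>). cell_poly P T (\<lambda>x. v x + c *\<^sub>R w x) x)
      = (\<Sum>T | T \<in> cells \<and> x \<in> closure (interior T \<inter> \<Omega>). cell_poly P T v x + c *\<^sub>R cell_poly P T w x)"
    by (intro sum.cong) auto
  thus ?thesis
    by (simp add: bdry_trace_def Let_def sum.distrib scaleR_sum_right[symmetric] scaleR_add_right mult.commute)
qed

lemma bdry_trace_null:
  assumes P: "polynomial_local_space P" and v: "piecewise cells P v" "v \<in> null_funs \<Omega>h"
  shows "bdry_trace S D P v x = 0"
proof -
  obtain m where m: "P \<subseteq> polys m"
    using P by (auto simp: polynomial_local_space_def)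
  have "cell_poly P T v x = 0"
    if "T \<in> {T \<in> cells. x \<in> closure (interior T \<inter> \<Omega>)}" for T
    using that by (intro cell_poly_null[OF m v] adjacent_closure_interior) auto
  thus ?thesis by (simp add: bdry_trace_def Let_def)
qed

text \<open>The surface measure has the Borel sets as its measurable sets by construction, whether or not
  the Hausdorff outer measure is countably additive on them.\<close>

lemma sets_surface_measure: "sets (surface_measure :: 'a measure) = sets borel"
  unfolding surface_measure_def using sets.sigma_sets_eq[of "borel :: 'a measure"]
  by (simp add: sets_measure_of_conv)

lemma space_surface_measure: "space (surface_measure :: 'a measure) = UNIV"
  by (simp add: surface_measure_def space_measure_of_conv)

lemma finite_measure_Gamma_u: "finite_measure (surface_on (Gamma_u S))"
proof
  have "emeasure (surface_on (Gamma_u S)) (space (surface_on (Gamma_u S)))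
      = emeasure surface_measure (Gamma_u S)"
    using Gamma_u(1) by (simp add: emeasure_restrict_space space_restrict_space space_surface_measure
        sets_surface_measure)
  also have "\<dots> \<le> emeasure surface_measure (frontier \<Omega>)"
    using Gamma_u by (intro emeasure_mono) (auto simp: sets_surface_measure)
  also have "\<dots> < \<infinity>" by (rule surface)
  finally show "emeasure (surface_on (Gamma_u S)) (space (surface_on (Gamma_u S))) \<noteq> \<infinity>" by simp
qed

lemma normal_Gamma_u:
  "normal S \<in> borel_measurable (surface_on (Gamma_u S))"
  "AE x in surface_on (Gamma_u S). norm (normal S x) = 1"
proof -
  show "normal S \<in> borel_measurable (surface_on (Gamma_u S))"
    using normal(1) Gamma_u(2) measurable_restrict_mono by blast
  have "frontier \<Omega> \<in> sets borel" by simp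
  hence "AE x in surface_measure. x \<in> frontier \<Omega> \<longrightarrow> norm (normal S x) = 1"
    using normal(2) by (simp add: AE_restrict_space_iff sets_surface_measure space_surface_measure)
  hence "AE x in surface_measure. x \<in> Gamma_u S \<longrightarrow> norm (normal S x) = 1"
    using Gamma_u(2) by (auto elim!: eventually_mono)
  thus "AE x in surface_on (Gamma_u S). norm (normal S x) = 1"
    using Gamma_u(1) by (simp add: AE_restrict_space_iff sets_surface_measure space_surface_measure)
qed

lemma bdry_trace_measurable_bounded:
  fixes v :: "'a \<Rightarrow> 'b::euclidean_space"
  assumes P: "polynomial_local_space P" and v: "piecewise cells P v"
  shows "bdry_trace S D P v \<in> borel_measurable (surface_on (Gamma_u S))"
    and "\<exists>C. \<forall>x\<in>Gamma_u S. norm (bdry_trace S D P v x) \<le> C"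
proof -
  obtain m where m: "P \<subseteq> polys m"
    using P by (auto simp: polynomial_local_space_def)
  define K where "K T = closure (interior T \<inter> \<Omega>)" for T
  define f where "f T = cell_poly P T v" for T
  have f: "continuous_on A (f T)" if "T \<in> cells" for T A
    unfolding f_def using m v that by (rule cell_poly_continuous)
  have eq: "bdry_trace S D P v x = (1 / (\<Sum>T\<in>cells. if x \<in> K T then 1 else 0)) *\<^sub>R
      (\<Sum>T\<in>cells. if x \<in> K T then f T x else 0)" for x
    using finite_cells
    by (simp add: bdry_trace_def Let_def K_def f_def sum.inter_filter[symmetric])
  have [measurable]: "f T \<in> borel_measurable borel" if "T \<in> cells" for T
    using f[OF that, of UNIV] by (rule borel_measurable_continuous_onI)
  have [measurable]: "K T \<in> sets borel" for T by (simp add: K_def)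
  have "bdry_trace S D P v \<in> borel_measurable borel"
    unfolding eq[abs_def] by measurable
  hence "bdry_trace S D P v \<in> borel_measurable surface_measure"
    using measurable_cong_sets[OF sets_surface_measure refl] by blast
  thus "bdry_trace S D P v \<in> borel_measurable (surface_on (Gamma_u S))"
    by (rule measurable_restrict_space1)
  have "compact ((\<lambda>x. \<Sum>T\<in>cells. norm (f T x)) ` closure \<Omega>)"
    using bounded_Omega by (intro compact_continuous_image continuous_intros f) auto
  from compact_imp_bounded[OF this] obtain C where
    C: "\<And>x. x \<in> closure \<Omega> \<Longrightarrow> \<bar>\<Sum>T\<in>cells. norm (f T x)\<bar> \<le> C"
    by (auto simp: bounded_iff)
  have "norm (bdry_trace S D P v x) \<le> C" if x: "x \<in> Gamma_u S" for x
  proof -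
    define N where "N = {T \<in> cells. x \<in> K T}"
    have N: "finite N" "N \<subseteq> cells" using finite_cells by (auto simp: N_def)
    have "norm (bdry_trace S D P v x) = (1 / real (card N)) * norm (\<Sum>T\<in>N. f T x)"
      by (simp add: bdry_trace_def Let_def N_def K_def f_def)
    also have "\<dots> \<le> 1 * norm (\<Sum>T\<in>N. f T x)"
      by (intro mult_right_mono) (auto simp: divide_le_eq)
    also have "\<dots> \<le> (\<Sum>T\<in>N. norm (f T x))" by (simp add: norm_sum)
    also have "\<dots> \<le> (\<Sum>T\<in>cells. norm (f T x))"
      using N finite_cells by (intro sum_mono2) auto
    also have "\<dots> \<le> C"
      using C[of x] x Gamma_u(2) by (auto simp: frontier_def)
    finally show ?thesis .
  qed
  thus "\<exists>C. \<forall>x\<in>Gamma_u S. norm (bdry_trace S D P v x) \<le> C" by blast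
qed

lemma space_Gamma_u: "space (surface_on (Gamma_u S)) = Gamma_u S"
  by (simp add: space_restrict_space space_surface_measure)

lemma bdry_trace_L2:
  fixes v :: "'a \<Rightarrow> 'b::euclidean_space"
  assumes "polynomial_local_space P" "piecewise cells P v"
  shows "bdry_trace S D P v \<in> L2_space (surface_on (Gamma_u S))"
proof -
  obtain C where "\<forall>x\<in>Gamma_u S. norm (bdry_trace S D P v x) \<le> C"
    using bdry_trace_measurable_bounded(2)[OF assms] by blast
  thus ?thesis
    by (intro L2_space_bounded[OF finite_measure_Gamma_u bdry_trace_measurable_bounded(1)[OF assms]] AE_I2) (auto simp: space_Gamma_u)

qed

lemma normal_trace_L2:
  assumes "v \<in> V_d S D"
  shows "normal_trace S D v \<in> L2_space (surface_on (Gamma_u S))"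
proof -
  have pw: "piecewise cells (poly_d S) v" using assms by (simp add: V_d_iff)
  obtain C where C: "\<forall>x\<in>Gamma_u S. norm (bdry_trace S D (poly_d S) v x) \<le> C"
    using bdry_trace_measurable_bounded(2)[OF poly_d pw] by blast
  note [measurable] = bdry_trace_measurable_bounded(1)[OF poly_d pw] normal_Gamma_u(1)
  show ?thesis
  proof (rule L2_space_bounded[OF finite_measure_Gamma_u])
    show "normal_trace S D v \<in> borel_measurable (surface_on (Gamma_u S))"
      unfolding normal_trace_def[abs_def] by measurable
    have "AE x in surface_on (Gamma_u S). norm (bdry_trace S D (poly_d S) v x) \<le> C"
      using C by (intro AE_I2) (simp add: space_Gamma_u)
    with normal_Gamma_u(2) show "AE x in surface_on (Gamma_u S). norm (normal_trace S D v x) \<le> C"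
    proof eventually_elim
      case (elim x)
      have "\<bar>bdry_trace S D (poly_d S) v x \<bullet> normal S x\<bar>
          \<le> norm (bdry_trace S D (poly_d S) v x) * norm (normal S x)"
        by (rule Cauchy_Schwarz_ineq2)
      thus ?case using elim by (simp add: normal_trace_def)
    qed
  qed
qed

lemma normal_trace_lincomb:
  assumes "v \<in> V_d S D" "w \<in> V_d S D"
  shows "normal_trace S D (\<lambda>x. v x + c *\<^sub>R w x) = (\<lambda>x. normal_trace S D v x + c *\<^sub>R normal_trace S D w x)"
proof
  fix x
  have "piecewise cells (poly_d S) v" "piecewise cells (poly_d S) w"
    using assms by (simp_all add: V_d_iff)
  from bdry_trace_lincomb[OF poly_d this]
  show "normal_trace S D (\<lambda>x. v x + c *\<^sub>R w x) x = normal_trace S D v x + c *\<^sub>R normal_trace S D w x"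
    unfolding normal_trace_def by (simp only: inner_add_left inner_scaleR_left real_scaleR_def)
qed

lemma normal_trace_null:
  assumes "v \<in> V_d S D" "v \<in> null_funs \<Omega>h"
  shows "normal_trace S D v = (\<lambda>x. 0)"
proof
  fix x
  have "piecewise cells (poly_d S) v" using assms(1) by (simp add: V_d_iff)
  from bdry_trace_null[OF poly_d this assms(2)]
  show "normal_trace S D v x = 0" unfolding normal_trace_def by (simp only: inner_zero_left)
qed

end

section \<open>The bilinear forms\<close>

lemma lincomb_fun: "v + c *\<^sub>R w = (\<lambda>x. v x + c *\<^sub>R w x)"
  by (simp add: fun_eq_iff)

lemma bilinear_on_left:
  "bilinear_on \<omega> V s \<Longrightarrow> u \<in> V \<Longrightarrow> u' \<in> V \<Longrightarrow> v \<in> V \<Longrightarrow> s (u + c *\<^sub>R u') v = s u v + c * s u' v"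
  unfolding bilinear_on_def lincomb_fun by blast

lemma bilinear_on_right:
  "bilinear_on \<omega> V s \<Longrightarrow> u \<in> V \<Longrightarrow> v \<in> V \<Longrightarrow> v' \<in> V \<Longrightarrow> s u (v + c *\<^sub>R v') = s u v + c * s u v'"
  unfolding bilinear_on_def lincomb_fun by blast

lemma bilinear_on_cong:
  "bilinear_on \<omega> V s \<Longrightarrow> u \<in> V \<Longrightarrow> u' \<in> V \<Longrightarrow> v \<in> V \<Longrightarrow> v' \<in> V \<Longrightarrow> ae_eq \<omega> u u' \<Longrightarrow> ae_eq \<omega> v v' \<Longrightarrow>
    s u v = s u' v'"
  unfolding bilinear_on_def by blast

lemma bilinear_on_null_right:
  assumes s: "bilinear_on \<omega> V s" and V: "subspace V" and uv: "u \<in> V" "v \<in> V" "v \<in> null_funs \<omega>"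
  shows "s u v = 0"
proof -
  have 0: "0 \<in> V" using V by (rule subspace_0)
  have "s u v = s u 0"
    using uv 0 by (intro bilinear_on_cong[OF s]) (simp_all add: null_funs_def)
  moreover have "s u (0 + 1 *\<^sub>R 0) = s u 0 + 1 * s u 0"
    by (rule bilinear_on_right[OF s uv(1) 0 0])
  ultimately show ?thesis by simp
qed

text \<open>The form \<open>A\<close> of the introduction; its Riesz-type equation defines the stabilised projection.\<close>

definition stab_form ::
    "'a::euclidean_space setting \<Rightarrow> 'a discretisation \<Rightarrow> real \<Rightarrow> ('a \<Rightarrow> real) \<Rightarrow> ('a \<Rightarrow> real) \<Rightarrow> real" where
  "stab_form S D \<tau>0 z q = L2_inner (lebesgue_on (Omega S)) z q + \<tau>0 * stab_0 D z q"

lemma b_h_eq_stab_form: "b_h S D \<tau>0 v q = - stab_form S D \<tau>0 (Div S D v) q"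
  by (simp add: b_h_def stab_form_def)

context cut_discretisation
begin

lemma null_on_Omega:
  assumes "v \<in> null_funs \<Omega>h"
  shows "AE x in lebesgue_on \<Omega>. v x = 0"
proof -
  have "AE x in lebesgue_on \<Omega>h. v x = 0" using assms by (simp add: null_funs_def)
  thus ?thesis by (rule AE_lebesgue_on_subset[OF Omega_h_measurable Omega_measurable Omega_subset])
qed

lemma V_d_comb: "v \<in> V_d S D \<Longrightarrow> w \<in> V_d S D \<Longrightarrow> v + c *\<^sub>R w \<in> V_d S D"
  unfolding lincomb_fun by (rule V_d_lincomb)

lemma V_0_comb: "v \<in> V_0 S D \<Longrightarrow> w \<in> V_0 S D \<Longrightarrow> v + c *\<^sub>R w \<in> V_0 S D"
  unfolding lincomb_fun by (rule V_0_lincomb)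

lemma stab_form_left:
  assumes "z \<in> V_0 S D" "z' \<in> V_0 S D" "q \<in> V_0 S D"
  shows "stab_form S D \<tau>0 (z + c *\<^sub>R z') q = stab_form S D \<tau>0 z q + c * stab_form S D \<tau>0 z' q"
proof -
  have "L2_inner (lebesgue_on \<Omega>) (z + c *\<^sub>R z') q
      = L2_inner (lebesgue_on \<Omega>) z q + c * L2_inner (lebesgue_on \<Omega>) z' q"
    unfolding lincomb_fun by (intro L2_inner_lincomb_left V_0_L2_Omega assms)
  moreover have "stab_0 D (z + c *\<^sub>R z') q = stab_0 D z q + c * stab_0 D z' q"
    using assms by (rule bilinear_on_left[OF stab_0])
  ultimately show ?thesis by (simp add: stab_form_def algebra_simps)
qed

lemma stab_form_right:
  assumes "z \<in> V_0 S D" "q \<in> V_0 S D" "q' \<in> V_0 S D"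
  shows "stab_form S D \<tau>0 z (q + c *\<^sub>R q') = stab_form S D \<tau>0 z q + c * stab_form S D \<tau>0 z q'"
proof -
  have "L2_inner (lebesgue_on \<Omega>) z (q + c *\<^sub>R q')
      = L2_inner (lebesgue_on \<Omega>) z q + c * L2_inner (lebesgue_on \<Omega>) z q'"
    unfolding lincomb_fun by (intro L2_inner_lincomb_right V_0_L2_Omega assms)
  moreover have "stab_0 D z (q + c *\<^sub>R q') = stab_0 D z q + c * stab_0 D z q'"
    using assms by (rule bilinear_on_right[OF stab_0])
  ultimately show ?thesis by (simp add: stab_form_def algebra_simps)
qed

lemma stab_form_null_right:
  assumes "z \<in> V_0 S D" "q \<in> V_0 S D" "q \<in> null_funs \<Omega>h"
  shows "stab_form S D \<tau>0 z q = 0"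
proof -
  have "L2_inner (lebesgue_on \<Omega>) z q = 0"
    unfolding L2_inner_commute[of _ z] using null_on_Omega[OF assms(3)] by (rule L2_inner_zero_AE)
  moreover have "stab_0 D z q = 0" using assms by (rule bilinear_on_null_right[OF stab_0 subspace_V_0])
  ultimately show ?thesis by (simp add: stab_form_def)
qed

lemma stab_form_null_left:
  assumes "z \<in> V_0 S D" "q \<in> V_0 S D" "z \<in> null_funs \<Omega>h"
  shows "stab_form S D \<tau>0 z q = 0"
proof -
  have 0: "0 \<in> V_0 S D" using subspace_V_0 by (rule subspace_0)
  have "L2_inner (lebesgue_on \<Omega>) z q = 0"
    using null_on_Omega[OF assms(3)] by (rule L2_inner_zero_AE)
  moreover have "stab_0 D z q = stab_0 D 0 q"
    using assms 0 by (intro bilinear_on_cong[OF stab_0]) (simp_all add: null_funs_def)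
  moreover have "stab_0 D 0 q = 0"
    using stab_0_const[OF assms(2), of 0] by (simp add: zero_fun_def)
  ultimately show ?thesis by (simp add: stab_form_def)
qed

lemma stab_form_const_left:
  assumes "q \<in> V_0 S D"
  shows "stab_form S D \<tau>0 (\<lambda>x. 1) q = (\<integral>x. q x \<partial>lebesgue_on \<Omega>)"
  using stab_0_const[OF assms, of 1] by (simp add: stab_form_def L2_inner_def)

lemma stab_form_cong_left:
  assumes "z \<in> V_0 S D" "z' \<in> V_0 S D" "q \<in> V_0 S D" "ae_eq \<Omega>h z z'"
  shows "stab_form S D \<tau>0 z q = stab_form S D \<tau>0 z' q"
proof -
  have d: "z' + (-1) *\<^sub>R z \<in> V_0 S D" using assms(2,1) by (rule V_0_comb)
  have "z' + (-1) *\<^sub>R z \<in> null_funs \<Omega>h"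
    unfolding null_funs_def using assms(4) by (auto elim!: eventually_mono)
  from stab_form_null_left[OF d assms(3) this] stab_form_left[OF assms(2,1,3), of \<tau>0 "-1"]
  show ?thesis by simp
qed

lemma b_h_left:
  assumes "v \<in> V_d S D" "w \<in> V_d S D" "q \<in> V_0 S D"
  shows "b_h S D \<tau>0 (v + c *\<^sub>R w) q = b_h S D \<tau>0 v q + c * b_h S D \<tau>0 w q"
proof -
  note Dv = Div_V0[OF assms(1)] Div_V0[OF assms(2)]
  have "stab_form S D \<tau>0 (Div S D (v + c *\<^sub>R w)) q = stab_form S D \<tau>0 (Div S D v + c *\<^sub>R Div S D w) q"
  proof (rule stab_form_cong_left[OF Div_V0[OF V_d_comb[OF assms(1,2)]] V_0_comb[OF Dv] assms(3)])
    show "ae_eq \<Omega>h (Div S D (v + c *\<^sub>R w)) (Div S D v + c *\<^sub>R Div S D w)"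
      unfolding lincomb_fun by (rule Div_lincomb[OF assms(1,2)])
  qed
  thus ?thesis unfolding b_h_eq_stab_form stab_form_left[OF Dv assms(3)] by simp
qed

lemma b_h_right:
  assumes "v \<in> V_d S D" "q \<in> V_0 S D" "q' \<in> V_0 S D"
  shows "b_h S D \<tau>0 v (q + c *\<^sub>R q') = b_h S D \<tau>0 v q + c * b_h S D \<tau>0 v q'"
  unfolding b_h_eq_stab_form stab_form_right[OF Div_V0[OF assms(1)] assms(2,3)] by simp

lemma b_h_null_left:
  assumes "v \<in> V_d S D" "q \<in> V_0 S D" "v \<in> null_funs \<Omega>h"
  shows "b_h S D \<tau>0 v q = 0"
  unfolding b_h_eq_stab_form
    stab_form_null_left[OF Div_V0[OF assms(1)] assms(2) Div_null[OF assms(1,3)]] by simp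

lemma b_h_null_right:
  assumes "v \<in> V_d S D" "q \<in> V_0 S D" "q \<in> null_funs \<Omega>h"
  shows "b_h S D \<tau>0 v q = 0"
  unfolding b_h_eq_stab_form stab_form_null_right[OF Div_V0[OF assms(1)] assms(2,3)] by simp

lemma pressure_trace_L2: "q \<in> V_0 S D \<Longrightarrow> bdry_trace S D (poly_0 S) q \<in> L2_space (surface_on (Gamma_u S))"
  by (rule bdry_trace_L2[OF poly_0]) (simp add: V_0_iff)

lemma pressure_trace_comb:
  assumes "q \<in> V_0 S D" "q' \<in> V_0 S D"
  shows "bdry_trace S D (poly_0 S) (q + c *\<^sub>R q')
    = (\<lambda>x. bdry_trace S D (poly_0 S) q x + c *\<^sub>R bdry_trace S D (poly_0 S) q' x)"
proof
  fix x
  have "piecewise cells (poly_0 S) q" "piecewise cells (poly_0 S) q'"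
    using assms by (simp_all add: V_0_iff)
  from bdry_trace_lincomb[OF poly_0 this]
  show "bdry_trace S D (poly_0 S) (q + c *\<^sub>R q') x
    = bdry_trace S D (poly_0 S) q x + c *\<^sub>R bdry_trace S D (poly_0 S) q' x"
    unfolding lincomb_fun .
qed

lemma normal_trace_comb:
  assumes "v \<in> V_d S D" "w \<in> V_d S D"
  shows "normal_trace S D (v + c *\<^sub>R w) = (\<lambda>x. normal_trace S D v x + c *\<^sub>R normal_trace S D w x)"
  unfolding lincomb_fun by (rule normal_trace_lincomb[OF assms])

lemma b_tilde_h_left:
  assumes "v \<in> V_d S D" "w \<in> V_d S D" "q \<in> V_0 S D"
  shows "b_tilde_h S D \<tau>0 (v + c *\<^sub>R w) q = b_tilde_h S D \<tau>0 v q + c * b_tilde_h S D \<tau>0 w q"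
  unfolding b_tilde_h_def b_h_left[OF assms] normal_trace_comb[OF assms(1,2)]
    L2_inner_lincomb_left[OF normal_trace_L2[OF assms(1)] normal_trace_L2[OF assms(2)] pressure_trace_L2[OF assms(3)]]
  by (simp add: algebra_simps)

lemma b_tilde_h_right:
  assumes "v \<in> V_d S D" "q \<in> V_0 S D" "q' \<in> V_0 S D"
  shows "b_tilde_h S D \<tau>0 v (q + c *\<^sub>R q') = b_tilde_h S D \<tau>0 v q + c * b_tilde_h S D \<tau>0 v q'"
  unfolding b_tilde_h_def b_h_right[OF assms] pressure_trace_comb[OF assms(2,3)]
    L2_inner_lincomb_right[OF normal_trace_L2[OF assms(1)] pressure_trace_L2[OF assms(2)] pressure_trace_L2[OF assms(3)]]
  by (simp add: algebra_simps)

lemma b_tilde_h_null_left: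
  assumes "v \<in> V_d S D" "q \<in> V_0 S D" "v \<in> null_funs \<Omega>h"
  shows "b_tilde_h S D \<tau>0 v q = 0"
  unfolding b_tilde_h_def b_h_null_left[OF assms] normal_trace_null[OF assms(1,3)]
  by (simp add: L2_inner_def)

lemma a_h_left:
  assumes "u \<in> V_d S D" "w \<in> V_d S D" "v \<in> V_d S D"
  shows "a_h S D \<gamma> \<tau>d (u + c *\<^sub>R w) v = a_h S D \<gamma> \<tau>d u v + c * a_h S D \<gamma> \<tau>d w v"
proof -
  have "L2_inner (lebesgue_on \<Omega>) (u + c *\<^sub>R w) v
      = L2_inner (lebesgue_on \<Omega>) u v + c * L2_inner (lebesgue_on \<Omega>) w v"
    unfolding lincomb_fun by (intro L2_inner_lincomb_left V_d_L2_Omega assms)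
  thus ?thesis
    unfolding a_h_def normal_trace_comb[OF assms(1,2)] bilinear_on_left[OF stab_d assms]
      L2_inner_lincomb_left[OF normal_trace_L2[OF assms(1)] normal_trace_L2[OF assms(2)] normal_trace_L2[OF assms(3)]]
    by (simp add: algebra_simps)
qed

lemma a_h_right:
  assumes "u \<in> V_d S D" "v \<in> V_d S D" "w \<in> V_d S D"
  shows "a_h S D \<gamma> \<tau>d u (v + c *\<^sub>R w) = a_h S D \<gamma> \<tau>d u v + c * a_h S D \<gamma> \<tau>d u w"
proof -
  have "L2_inner (lebesgue_on \<Omega>) u (v + c *\<^sub>R w)
      = L2_inner (lebesgue_on \<Omega>) u v + c * L2_inner (lebesgue_on \<Omega>) u w"
    unfolding lincomb_fun by (intro L2_inner_lincomb_right V_d_L2_Omega assms)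
  thus ?thesis
    unfolding a_h_def normal_trace_comb[OF assms(2,3)] bilinear_on_right[OF stab_d assms]
      L2_inner_lincomb_right[OF normal_trace_L2[OF assms(1)] normal_trace_L2[OF assms(2)] normal_trace_L2[OF assms(3)]]
    by (simp add: algebra_simps)
qed

lemma a_h_null_right:
  assumes "u \<in> V_d S D" "v \<in> V_d S D" "v \<in> null_funs \<Omega>h"
  shows "a_h S D \<gamma> \<tau>d u v = 0"
proof -
  have "L2_inner (lebesgue_on \<Omega>) u v = 0"
    unfolding L2_inner_commute[of _ u] using null_on_Omega[OF assms(3)] by (rule L2_inner_zero_AE)
  thus ?thesis
    unfolding a_h_def normal_trace_null[OF assms(2,3)] bilinear_on_null_right[OF stab_d subspace_V_d assms]
    by (simp add: L2_inner_def)
qed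

lemma pressure_space_subset: "pressure_space S D \<subseteq> V_0 S D"
  by (auto simp: pressure_space_def)

lemma integral_comb:
  assumes "q \<in> V_0 S D" "q' \<in> V_0 S D"
  shows "(\<integral>x. (q + c *\<^sub>R q') x \<partial>lebesgue_on \<Omega>)
    = (\<integral>x. q x \<partial>lebesgue_on \<Omega>) + c * (\<integral>x. q' x \<partial>lebesgue_on \<Omega>)"
  using stab_form_right[OF constant_in_V_0[of 1] assms, of 0 c]
  unfolding stab_form_const_left[OF assms(1)] stab_form_const_left[OF assms(2)]
    stab_form_const_left[OF V_0_comb[OF assms]] .

lemma subspace_pressure_space: "subspace (pressure_space S D)"
proof -
  have "subspace {q \<in> V_0 S D. (\<integral>x. q x \<partial>lebesgue_on \<Omega>) = 0}"
    unfolding linear_space_iff_subspace[symmetric] linear_space_def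
  proof (intro conjI ballI allI)
    show "(\<lambda>x. 0) \<in> {q \<in> V_0 S D. (\<integral>x. q x \<partial>lebesgue_on \<Omega>) = 0}"
      by (simp add: constant_in_V_0)
    fix u v and c :: real
    assume uv: "u \<in> {q \<in> V_0 S D. (\<integral>x. q x \<partial>lebesgue_on \<Omega>) = 0}"
      "v \<in> {q \<in> V_0 S D. (\<integral>x. q x \<partial>lebesgue_on \<Omega>) = 0}"
    hence "u + c *\<^sub>R v \<in> {q \<in> V_0 S D. (\<integral>x. q x \<partial>lebesgue_on \<Omega>) = 0}"
      using integral_comb[of u v c] V_0_comb[of u v c] by (simp only: mem_Collect_eq) simp
    thus "(\<lambda>x. u x + c *\<^sub>R v x) \<in> {q \<in> V_0 S D. (\<integral>x. q x \<partial>lebesgue_on \<Omega>) = 0}"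
      unfolding lincomb_fun .
  qed
  thus ?thesis using subspace_V_0 by (simp add: pressure_space_def)
qed

section \<open>Consequences of unique solvability\<close>

text \<open>A solution of the homogeneous discrete problem can be added to the given solution, so by
  uniqueness it is a null function. The form \<open>M\<close> collects both discrete equations, with trial and test
  functions from the same product space; its nondegeneracy therefore makes the system solvable with
  right-hand side \<open>l\<close> in the second equation and zero in the first.\<close>

lemma unique_solvability_imp_stab_form_onto_pressure:
  fixes l :: "('a \<Rightarrow> real) \<Rightarrow> real"
  assumes sol: "is_the_discrete_solution S D \<gamma> \<tau>d \<tau>0 f g u\<Gamma> p\<Gamma> u p"
    and llin: "\<And>q q' c. q \<in> V_0 S D \<Longrightarrow> q' \<in> V_0 S D \<Longrightarrow> l (q + c *\<^sub>R q') = l q + c * l q'"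
    and lnull: "\<And>q. q \<in> V_0 S D \<Longrightarrow> q \<in> null_funs \<Omega>h \<Longrightarrow> l q = 0"
  shows "\<exists>z\<in>V_0 S D. \<forall>q\<in>pressure_space S D. stab_form S D \<tau>0 z q = l q"
proof -
  define P where "P = pressure_space S D"
  define X where "X = V_d S D \<times> P"
  define N where "N = (null_funs \<Omega>h :: ('a \<Rightarrow> 'a) set) \<times> (null_funs \<Omega>h :: ('a \<Rightarrow> real) set)"
  define M where "M x y = a_h S D \<gamma> \<tau>d (fst x) (fst y) + b_tilde_h S D \<tau>0 (fst y) (snd x)
      + b_h S D \<tau>0 (fst x) (snd y)" for x y
  have P: "q \<in> V_0 S D" if "q \<in> P" for q using that pressure_space_subset by (auto simp: P_def)
  have subP: "subspace P" unfolding P_def by (rule subspace_pressure_space)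
  have P0: "0 \<in> P" using subP by (rule subspace_0)
  have V0: "0 \<in> V_d S D" using subspace_V_d by (rule subspace_0)
  have n0: "0 \<in> null_funs \<Omega>h" by (rule subspace_0[OF subspace_null_funs])
  have n0': "(0 :: 'a \<Rightarrow> 'a) \<in> null_funs \<Omega>h" by (rule subspace_0[OF subspace_null_funs])
  have X: "fst x \<in> V_d S D" "snd x \<in> P" "snd x \<in> V_0 S D" if "x \<in> X" for x
    using that P by (auto simp: X_def)
  obtain Bd :: "('a \<Rightarrow> 'a) set" where Bd: "finite Bd" "\<And>v. v \<in> V_d S D \<Longrightarrow> \<exists>b\<in>span Bd. v - b \<in> null_funs \<Omega>h"
    using V_d_finite_dim by metis
  obtain Bp :: "('a \<Rightarrow> real) set" where Bp: "finite Bp" "\<And>v. v \<in> V_0 S D \<Longrightarrow> \<exists>b\<in>span Bp. v - b \<in> null_funs \<Omega>h"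
    using V_0_finite_dim by metis
  define B where "B = (\<lambda>b. (b, 0 :: 'a \<Rightarrow> real)) ` Bd \<union> (\<lambda>b. (0 :: 'a \<Rightarrow> 'a, b)) ` Bp"
  have spans: "\<exists>b\<in>span B. x - b \<in> N" if x: "x \<in> X" for x
  proof -
    obtain b where b: "b \<in> span Bd" "fst x - b \<in> null_funs \<Omega>h" using Bd(2)[OF X(1)[OF x]] by blast
    obtain b' where b': "b' \<in> span Bp" "snd x - b' \<in> null_funs \<Omega>h" using Bp(2)[OF X(3)[OF x]] by blast
    have lin: "linear (\<lambda>b. (b, 0 :: 'a \<Rightarrow> real))" "linear (\<lambda>b. (0 :: 'a \<Rightarrow> 'a, b :: 'a \<Rightarrow> real))"
      by (auto intro!: linearI)
    have "(b, 0) \<in> span ((\<lambda>b. (b, 0 :: 'a \<Rightarrow> real)) ` Bd)"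
      unfolding linear_span_image[OF lin(1)] using b(1) by blast
    hence 1: "(b, 0) \<in> span B" by (rule rev_subsetD[OF _ span_mono]) (simp add: B_def)
    have "(0, b') \<in> span ((\<lambda>b. (0 :: 'a \<Rightarrow> 'a, b)) ` Bp)"
      unfolding linear_span_image[OF lin(2)] using b'(1) by blast
    hence 2: "(0, b') \<in> span B" by (rule rev_subsetD[OF _ span_mono]) (simp add: B_def)
    have "(b, b') \<in> span B" using span_add[OF 1 2] by simp
    moreover have "x - (b, b') \<in> N" using b(2) b'(2) by (cases x) (simp add: N_def)
    ultimately show ?thesis by blast
  qed
  have Msplit: "M x (0, q) = b_h S D \<tau>0 (fst x) q" if "x \<in> X" "q \<in> P" for x q
    using a_h_null_right[OF X(1)[OF that(1)] V0 n0'] b_tilde_h_null_left[OF V0 X(3)[OF that(1)] n0']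
    by (simp add: M_def)
  have sol': "discrete_solution S D \<gamma> \<tau>d \<tau>0 f g u\<Gamma> p\<Gamma> u p"
    and uniq: "\<And>u' p'. discrete_solution S D \<gamma> \<tau>d \<tau>0 f g u\<Gamma> p\<Gamma> u' p' \<Longrightarrow> ae_eq \<Omega>h u' u \<and> ae_eq \<Omega>h p' p"
    using sol by (auto simp: is_the_discrete_solution_def)
  have up: "u \<in> V_d S D" "p \<in> P" using sol' by (simp_all add: discrete_solution_def P_def)
  have nondeg: "x \<in> N" if x: "x \<in> X" and Mx: "\<And>y. y \<in> X \<Longrightarrow> M x y = 0" for x
  proof -
    define w r where "w = fst x" and "r = snd x"
    have w: "w \<in> V_d S D" and r: "r \<in> P" using X[OF x] by (simp_all add: w_def r_def)
    have 1: "a_h S D \<gamma> \<tau>d w v + b_tilde_h S D \<tau>0 v r = 0" if v: "v \<in> V_d S D" for v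
      using Mx[of "(v, 0)"] v P0 b_h_null_right[OF w P[OF P0] n0]
      by (simp add: X_def M_def w_def r_def)
    have 2: "b_h S D \<tau>0 w q = 0" if q: "q \<in> P" for q
      using Mx[of "(0, q)"] Msplit[OF x q] q V0 by (simp add: X_def w_def)
    have "discrete_solution S D \<gamma> \<tau>d \<tau>0 f g u\<Gamma> p\<Gamma> (u + 1 *\<^sub>R w) (p + 1 *\<^sub>R r)"
      unfolding discrete_solution_def
    proof (intro conjI ballI)
      show "u + 1 *\<^sub>R w \<in> V_d S D" using up(1) w by (rule V_d_comb)
      show "p + 1 *\<^sub>R r \<in> pressure_space S D"
        using subspace_add[OF subP up(2) r] by (simp add: P_def)
    next
      fix v assume v: "v \<in> V_d S D"
      have "a_h S D \<gamma> \<tau>d (u + 1 *\<^sub>R w) v + b_tilde_h S D \<tau>0 v (p + 1 *\<^sub>R r)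
          = (a_h S D \<gamma> \<tau>d u v + b_tilde_h S D \<tau>0 v p) + (a_h S D \<gamma> \<tau>d w v + b_tilde_h S D \<tau>0 v r)"
        unfolding a_h_left[OF up(1) w v] b_tilde_h_right[OF v P[OF up(2)] P[OF r]] by simp
      also have "\<dots> = a_h S D \<gamma> \<tau>d u v + b_tilde_h S D \<tau>0 v p" using 1[OF v] by simp
      also have "\<dots> = L2_inner (lebesgue_on \<Omega>) f v
          + \<gamma> * inverse (mesh_size D) * L2_inner (surface_on (Gamma_u S)) u\<Gamma> (normal_trace S D v)
          - L2_inner (surface_on (Gamma_p S)) (normal_trace S D v) p\<Gamma>"
        using sol' v by (simp add: discrete_solution_def)
      finally show "a_h S D \<gamma> \<tau>d (u + 1 *\<^sub>R w) v + b_tilde_h S D \<tau>0 v (p + 1 *\<^sub>R r)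
          = L2_inner (lebesgue_on \<Omega>) f v
          + \<gamma> * inverse (mesh_size D) * L2_inner (surface_on (Gamma_u S)) u\<Gamma> (normal_trace S D v)
          - L2_inner (surface_on (Gamma_p S)) (normal_trace S D v) p\<Gamma>" .
    next
      fix q assume q: "q \<in> pressure_space S D"
      hence q': "q \<in> P" by (simp add: P_def)
      have "b_h S D \<tau>0 (u + 1 *\<^sub>R w) q = b_h S D \<tau>0 u q"
        unfolding b_h_left[OF up(1) w P[OF q']] 2[OF q'] by simp
      also have "\<dots> = L2_inner (lebesgue_on \<Omega>) g q" using sol' q by (simp add: discrete_solution_def)
      finally show "b_h S D \<tau>0 (u + 1 *\<^sub>R w) q = L2_inner (lebesgue_on \<Omega>) g q" .
    qed
    from uniq[OF this] have "w \<in> null_funs \<Omega>h" "r \<in> null_funs \<Omega>h"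
      by (auto simp: null_funs_def elim!: eventually_mono)
    thus "x \<in> N" unfolding N_def w_def r_def by (simp add: mem_Times_iff)
  qed
  have "\<exists>x\<in>X. \<forall>y\<in>X. M x y = l (snd y)"
  proof (rule nondegenerate_form_represents_functionals[of X N B M "\<lambda>y. l (snd y)"])
    show "subspace X" unfolding X_def by (intro subspace_Times subspace_V_d subP)
    show "subspace N" unfolding N_def by (intro subspace_Times subspace_null_funs)
    show "finite B" using Bd(1) Bp(1) by (simp add: B_def)
    show "\<exists>b\<in>span B. x - b \<in> N" if "x \<in> X" for x using that by (rule spans)
    show "M (x + c *\<^sub>R x') y = M x y + c * M x' y" if "x \<in> X" "x' \<in> X" "y \<in> X" for x x' y c
      unfolding M_def fst_add snd_add fst_scaleR snd_scaleR
        a_h_left[OF X(1)[OF that(1)] X(1)[OF that(2)] X(1)[OF that(3)]]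
        b_tilde_h_right[OF X(1)[OF that(3)] X(3)[OF that(1)] X(3)[OF that(2)]]
        b_h_left[OF X(1)[OF that(1)] X(1)[OF that(2)] X(3)[OF that(3)]]
      by (simp add: algebra_simps)
    show "M x (y + c *\<^sub>R y') = M x y + c * M x y'" if "x \<in> X" "y \<in> X" "y' \<in> X" for x y y' c
      unfolding M_def fst_add snd_add fst_scaleR snd_scaleR
        a_h_right[OF X(1)[OF that(1)] X(1)[OF that(2)] X(1)[OF that(3)]]
        b_tilde_h_left[OF X(1)[OF that(2)] X(1)[OF that(3)] X(3)[OF that(1)]]
        b_h_right[OF X(1)[OF that(1)] X(3)[OF that(2)] X(3)[OF that(3)]]
      by (simp add: algebra_simps)
    show "M x y = 0" if "x \<in> X" "y \<in> X" "y \<in> N" for x y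
    proof -
      have n: "fst y \<in> null_funs \<Omega>h" "snd y \<in> null_funs \<Omega>h" using that(3) by (auto simp: N_def)
      show ?thesis
        unfolding M_def a_h_null_right[OF X(1)[OF that(1)] X(1)[OF that(2)] n(1)]
          b_tilde_h_null_left[OF X(1)[OF that(2)] X(3)[OF that(1)] n(1)]
          b_h_null_right[OF X(1)[OF that(1)] X(3)[OF that(2)] n(2)] by simp
    qed
    show "x \<in> N" if "x \<in> X" "\<And>y. y \<in> X \<Longrightarrow> M x y = 0" for x using that by (rule nondeg)
    show "l (snd (y + c *\<^sub>R y')) = l (snd y) + c * l (snd y')" if "y \<in> X" "y' \<in> X" for y y' c
      unfolding snd_add snd_scaleR using X(3)[OF that(1)] X(3)[OF that(2)] by (rule llin)
    show "l (snd y) = 0" if "y \<in> X" "y \<in> N" for y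
      using that X(3)[OF that(1)] by (intro lnull) (auto simp: N_def)
  qed
  then obtain x where x: "x \<in> X" "\<And>y. y \<in> X \<Longrightarrow> M x y = l (snd y)" by blast
  note w = X(1)[OF x(1)]
  have Z: "0 \<in> V_0 S D" using subspace_V_0 by (rule subspace_0)
  \<comment> \<open>\<open>b_h\<close> carries a minus sign, so the negative divergence represents \<open>l\<close>\<close>
  define z where "z = 0 + (-1) *\<^sub>R Div S D (fst x)"
  have "z \<in> V_0 S D" unfolding z_def by (rule V_0_comb[OF Z Div_V0[OF w]])
  moreover have "stab_form S D \<tau>0 z q = l q" if q: "q \<in> P" for q
  proof -
    have "stab_form S D \<tau>0 z q = - stab_form S D \<tau>0 (Div S D (fst x)) q"
      unfolding z_def stab_form_left[OF Z Div_V0[OF w] P[OF q]] stab_form_null_left[OF Z P[OF q] n0] by simp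
    also have "\<dots> = M x (0, q)" unfolding Msplit[OF x(1) q] b_h_eq_stab_form ..
    also have "\<dots> = l q" using x(2)[of "(0, q)"] q V0 by (simp add: X_def)
    finally show ?thesis .
  qed
  ultimately show ?thesis unfolding P_def by blast
qed

lemma integral_one_pos: "(\<integral>x. 1 \<partial>lebesgue_on \<Omega>) > (0::real)"
proof -
  have "\<Omega> \<in> lmeasurable" using bounded_Omega Omega_measurable by (simp add: bounded_set_imp_lmeasurable)
  moreover have "\<not> negligible \<Omega>" using open_Omega Omega_nonempty by (rule open_not_negligible)
  ultimately have "measure lebesgue \<Omega> > 0"
    by (metis negligible_iff_measure0 measure_nonneg less_le)
  moreover have "(\<integral>x. 1 \<partial>lebesgue_on \<Omega>) = measure lebesgue \<Omega>"
    using Omega_measurable by (simp add: measure_restrict_space space_restrict_space)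
  ultimately show ?thesis by simp
qed

lemma mean_free_part:
  assumes "Gamma_p S = {}" "q \<in> V_0 S D"
  shows "q + (- ((\<integral>x. q x \<partial>lebesgue_on \<Omega>) / (\<integral>x. 1 \<partial>lebesgue_on \<Omega>))) *\<^sub>R (\<lambda>x. 1) \<in> pressure_space S D"
proof -
  define k where "k = (\<integral>x. q x \<partial>lebesgue_on \<Omega>) / (\<integral>x. 1 \<partial>lebesgue_on \<Omega>)"
  have "(\<integral>x. (q + (-k) *\<^sub>R (\<lambda>x. 1)) x \<partial>lebesgue_on \<Omega>)
      = (\<integral>x. q x \<partial>lebesgue_on \<Omega>) + (-k) * (\<integral>x. 1 \<partial>lebesgue_on \<Omega>)"
    by (rule integral_comb[OF assms(2) constant_in_V_0])
  also have "\<dots> = 0" unfolding k_def using integral_one_pos by (simp only: minus_mult_left[symmetric]) simp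
  finally have "(\<integral>x. (q + (-k) *\<^sub>R (\<lambda>x. 1)) x \<partial>lebesgue_on \<Omega>) = 0" .
  thus ?thesis
    unfolding pressure_space_def if_P[OF assms(1)] k_def[symmetric]
    using V_0_comb[OF assms(2) constant_in_V_0[of 1], of "-k"] by blast
qed

text \<open>If only test functions with mean zero are available, the remaining condition, with test function
  \<open>1\<close>, is met by adding a multiple of the constant \<open>1\<close>: this changes \<open>A(z, 1)\<close> but not \<open>A(z, q)\<close>
  for \<open>q\<close> with mean zero.\<close>

lemma stab_form_onto:
  fixes l :: "('a \<Rightarrow> real) \<Rightarrow> real"
  assumes sol: "is_the_discrete_solution S D \<gamma> \<tau>d \<tau>0 f g u\<Gamma> p\<Gamma> u p"
    and llin: "\<And>q q' c. q \<in> V_0 S D \<Longrightarrow> q' \<in> V_0 S D \<Longrightarrow> l (q + c *\<^sub>R q') = l q + c * l q'"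
    and lnull: "\<And>q. q \<in> V_0 S D \<Longrightarrow> q \<in> null_funs \<Omega>h \<Longrightarrow> l q = 0"
  shows "\<exists>z\<in>V_0 S D. \<forall>q\<in>V_0 S D. stab_form S D \<tau>0 z q = l q"
proof -
  obtain z0 where z0: "z0 \<in> V_0 S D" "\<And>q. q \<in> pressure_space S D \<Longrightarrow> stab_form S D \<tau>0 z0 q = l q"
    using unique_solvability_imp_stab_form_onto_pressure[OF assms] by blast
  show ?thesis
  proof (cases "Gamma_p S = {}")
    case False
    thus ?thesis using z0 by (auto simp: pressure_space_def)
  next
    case True
    let ?A = "stab_form S D \<tau>0"
    define e :: "'a \<Rightarrow> real" where "e = (\<lambda>x. 1)"
    define m :: real where "m = (\<integral>x. 1 \<partial>lebesgue_on \<Omega>)"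
    have m: "m > 0" unfolding m_def by (rule integral_one_pos)
    have e: "e \<in> V_0 S D" unfolding e_def by (rule constant_in_V_0)
    have Ae: "?A e q = (\<integral>x. q x \<partial>lebesgue_on \<Omega>)" if "q \<in> V_0 S D" for q
      unfolding e_def using that by (rule stab_form_const_left)
    have Aee: "?A e e = m" unfolding Ae[OF e] by (simp add: e_def m_def)
    define c where "c = (l e - ?A z0 e) / m"
    define z where "z = z0 + c *\<^sub>R e"
    have z: "z \<in> V_0 S D" unfolding z_def using z0(1) e by (rule V_0_comb)
    have ze: "?A z e = l e"
      unfolding z_def stab_form_left[OF z0(1) e e] Aee using m by (simp add: c_def)
    have "?A z q = l q" if q: "q \<in> V_0 S D" for q
    proof -
      define k where "k = (\<integral>x. q x \<partial>lebesgue_on \<Omega>) / m"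
      define q0 where "q0 = q + (-k) *\<^sub>R e"
      have q0P: "q0 \<in> pressure_space S D"
        unfolding q0_def k_def m_def e_def using True q by (rule mean_free_part)
      hence q0: "q0 \<in> V_0 S D" using pressure_space_subset by blast
      have Aq0: "?A e q0 = 0" using q0P True Ae[OF q0] by (simp add: pressure_space_def)
      have Aq: "?A z q0 = l q0"
        unfolding z_def stab_form_left[OF z0(1) e q0] Aq0 using z0(2)[OF q0P] by simp
      have eq: "q = q0 + k *\<^sub>R e" by (simp add: q0_def)
      have "?A z q = ?A z q0 + k * ?A z e" unfolding eq by (rule stab_form_right[OF z q0 e])
      also have "\<dots> = l q0 + k * l e" using Aq ze by simp
      also have "\<dots> = l q" unfolding eq by (rule llin[OF q0 e, symmetric])
      finally show ?thesis .
    qed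
    thus ?thesis using z by blast
  qed
qed

lemma L2_inner_functional:
  assumes "h \<in> L2_space (lebesgue_on \<omega>)" "\<omega> \<subseteq> \<Omega>h" "\<omega> \<in> sets lebesgue"
  shows "q \<in> V_0 S D \<Longrightarrow> q' \<in> V_0 S D \<Longrightarrow> L2_inner (lebesgue_on \<omega>) h (q + c *\<^sub>R q')
      = L2_inner (lebesgue_on \<omega>) h q + c * L2_inner (lebesgue_on \<omega>) h q'"
    and "q \<in> null_funs \<Omega>h \<Longrightarrow> L2_inner (lebesgue_on \<omega>) h q = 0"
proof -
  have L2: "q \<in> L2_space (lebesgue_on \<omega>)" if "q \<in> V_0 S D" for q
    using L2_space_subset[OF Omega_h_measurable assms(3,2) V_0_L2[OF that]] .
  show "L2_inner (lebesgue_on \<omega>) h (q + c *\<^sub>R q')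
      = L2_inner (lebesgue_on \<omega>) h q + c * L2_inner (lebesgue_on \<omega>) h q'"
    if "q \<in> V_0 S D" "q' \<in> V_0 S D"
    unfolding lincomb_fun by (rule L2_inner_lincomb_right[OF assms(1) L2[OF that(1)] L2[OF that(2)]])
  show "L2_inner (lebesgue_on \<omega>) h q = 0" if "q \<in> null_funs \<Omega>h"
  proof -
    have "AE x in lebesgue_on \<Omega>h. q x = 0" using that by (simp add: null_funs_def)
    hence "AE x in lebesgue_on \<omega>. q x = 0"
      by (rule AE_lebesgue_on_subset[OF Omega_h_measurable assms(3,2)])
    thus ?thesis unfolding L2_inner_commute[of _ h] by (rule L2_inner_zero_AE)
  qed
qed

text \<open>An onto map between spaces of equal finite dimension is injective. Concretely, surjectivity
  makes the transpose of \<open>A\<close> nondegenerate, hence also onto; then \<open>(_, z)\<close> is represented as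
  \<open>A(_, y)\<close>, and evaluating at \<open>z\<close> gives \<open>(z, z) = A(z, y) = 0\<close>, where the inner product is that
  of the active domain.\<close>

lemma stab_form_injective:
  assumes sol: "is_the_discrete_solution S D \<gamma> \<tau>d \<tau>0 f g u\<Gamma> p\<Gamma> u p"
    and z: "z \<in> V_0 S D" "\<And>q. q \<in> V_0 S D \<Longrightarrow> stab_form S D \<tau>0 z q = 0"
  shows "z \<in> null_funs \<Omega>h"
proof -
  let ?A = "stab_form S D \<tau>0" and ?I = "L2_inner (lebesgue_on \<Omega>h)"
  note I = L2_inner_functional[OF V_0_L2 subset_refl Omega_h_measurable]
  have null: "x \<in> null_funs \<Omega>h" if "x \<in> V_0 S D" "?I x x = 0" for x
    unfolding null_funs_def using L2_inner_self_zero[OF V_0_L2[OF that(1)] that(2)] by simp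
  obtain B :: "('a \<Rightarrow> real) set" where B: "finite B" "\<And>v. v \<in> V_0 S D \<Longrightarrow> \<exists>b\<in>span B. v - b \<in> null_funs \<Omega>h"
    using V_0_finite_dim by metis
  have nondeg: "x \<in> null_funs \<Omega>h" if x: "x \<in> V_0 S D" "\<And>y. y \<in> V_0 S D \<Longrightarrow> ?A y x = 0" for x
  proof -
    obtain y where "y \<in> V_0 S D" "\<forall>q\<in>V_0 S D. ?A y q = ?I x q"
      using stab_form_onto[OF sol, of "?I x"] I[OF x(1)] by blast
    hence "?I x x = 0" using x by metis
    with x(1) show ?thesis by (rule null)
  qed
  have "\<exists>y\<in>V_0 S D. \<forall>q\<in>V_0 S D. ?A q y = ?I z q"
  proof (rule nondegenerate_form_represents_functionals[of "V_0 S D" "null_funs \<Omega>h" B "\<lambda>x y. ?A y x" "?I z"])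
    show "?A y (x + c *\<^sub>R x') = ?A y x + c * ?A y x'"
      if "x \<in> V_0 S D" "x' \<in> V_0 S D" "y \<in> V_0 S D" for x x' y c
      by (rule stab_form_right[OF that(3,1,2)])
    show "?A (y + c *\<^sub>R y') x = ?A y x + c * ?A y' x"
      if "x \<in> V_0 S D" "y \<in> V_0 S D" "y' \<in> V_0 S D" for x y y' c
      by (rule stab_form_left[OF that(2,3,1)])
    show "?A y x = 0" if "x \<in> V_0 S D" "y \<in> V_0 S D" "y \<in> null_funs \<Omega>h" for x y
      by (rule stab_form_null_left[OF that(2,1,3)])
    show "x \<in> null_funs \<Omega>h" if "x \<in> V_0 S D" "\<And>y. y \<in> V_0 S D \<Longrightarrow> ?A y x = 0" for x
      using that by (rule nondeg)
    show "?I z (y + c *\<^sub>R y') = ?I z y + c * ?I z y'" if "y \<in> V_0 S D" "y' \<in> V_0 S D" for y y' c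
      by (rule I(1)[OF z(1) that])
    show "?I z y = 0" if "y \<in> V_0 S D" "y \<in> null_funs \<Omega>h" for y
      by (rule I(2)[OF z(1) that(2)])
  qed (use B in \<open>simp_all add: subspace_V_0 subspace_null_funs\<close>)
  then obtain y where y: "y \<in> V_0 S D" "\<And>q. q \<in> V_0 S D \<Longrightarrow> ?A q y = ?I z q" by blast
  have "?I z z = 0" using y(2)[OF z(1)] z(2)[OF y(1)] by simp
  with z(1) show ?thesis by (rule null)
qed

lemma stab_proj:
  assumes sol: "is_the_discrete_solution S D \<gamma> \<tau>d \<tau>0 f g u\<Gamma> p\<Gamma> u p"
    and r: "r \<in> L2_space (lebesgue_on \<Omega>)"
  shows "stab_proj S D \<tau>0 r \<in> V_0 S D"
    and "\<And>q. q \<in> V_0 S D \<Longrightarrow> stab_form S D \<tau>0 (stab_proj S D \<tau>0 r) q = L2_inner (lebesgue_on \<Omega>) r q"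
proof -
  note I = L2_inner_functional[OF r Omega_subset Omega_measurable]
  have "\<exists>z\<in>V_0 S D. \<forall>q\<in>V_0 S D. stab_form S D \<tau>0 z q = L2_inner (lebesgue_on \<Omega>) r q"
    using stab_form_onto[OF sol, of "L2_inner (lebesgue_on \<Omega>) r"] I by blast
  hence "\<exists>z. z \<in> V_0 S D \<and> (\<forall>q\<in>V_0 S D. L2_inner (lebesgue_on \<Omega>) z q + \<tau>0 * stab_0 D z q
      = L2_inner (lebesgue_on \<Omega>) r q)"
    unfolding stab_form_def by blast
  from someI_ex[OF this]
  have *: "stab_proj S D \<tau>0 r \<in> V_0 S D \<and> (\<forall>q\<in>V_0 S D. stab_form S D \<tau>0 (stab_proj S D \<tau>0 r) q
      = L2_inner (lebesgue_on \<Omega>) r q)"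
    unfolding stab_proj_def stab_form_def .
  show "stab_proj S D \<tau>0 r \<in> V_0 S D" using * by blast
  show "\<And>q. q \<in> V_0 S D \<Longrightarrow> stab_form S D \<tau>0 (stab_proj S D \<tau>0 r) q = L2_inner (lebesgue_on \<Omega>) r q"
    using * by blast
qed

lemma stab_proj_null:
  assumes sol: "is_the_discrete_solution S D \<gamma> \<tau>d \<tau>0 f g u\<Gamma> p\<Gamma> u p"
    and r: "r \<in> L2_space (lebesgue_on \<Omega>)" "AE x in lebesgue_on \<Omega>. r x = 0"
  shows "stab_proj S D \<tau>0 r \<in> null_funs \<Omega>h"
  using stab_form_injective[OF sol stab_proj(1)[OF sol r(1)]] stab_proj(2)[OF sol r(1)]
    L2_inner_zero_AE[OF r(2)] by simp

text \<open>The sum \<open>d\<close> of divergence and projection is \<open>A\<close>-orthogonal to the pressure space. The value of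
  \<open>c\<close> is the one for which \<open>A(d - c, 1) = 0\<close>.\<close>

lemma Div_plus_stab_proj_constant:
  assumes sol: "is_the_discrete_solution S D \<gamma> \<tau>d \<tau>0 f g u\<Gamma> p\<Gamma> u p"
    and g: "g \<in> L2_space (lebesgue_on \<Omega>)"
  shows "\<exists>c. (AE x in lebesgue_on \<Omega>h. Div S D u x = - stab_proj S D \<tau>0 g x + c) \<and> (Gamma_p S \<noteq> {} \<longrightarrow> c = 0)"
proof -
  let ?A = "stab_form S D \<tau>0"
  define z where "z = stab_proj S D \<tau>0 g"
  note z = stab_proj[OF sol g, folded z_def]
  have sol': "discrete_solution S D \<gamma> \<tau>d \<tau>0 f g u\<Gamma> p\<Gamma> u p"
    using sol by (simp add: is_the_discrete_solution_def)
  have u: "Div S D u \<in> V_0 S D" using sol' by (intro Div_V0) (simp add: discrete_solution_def)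
  define d where "d = z + 1 *\<^sub>R Div S D u"
  have d: "d \<in> V_0 S D" unfolding d_def using z(1) u by (rule V_0_comb)
  have dP: "?A d q = 0" if q: "q \<in> pressure_space S D" for q
  proof -
    have q0: "q \<in> V_0 S D" using q pressure_space_subset by blast
    have "b_h S D \<tau>0 u q = L2_inner (lebesgue_on \<Omega>) g q"
      using sol' q by (simp add: discrete_solution_def)
    hence "?A (Div S D u) q = - L2_inner (lebesgue_on \<Omega>) g q"
      unfolding b_h_eq_stab_form by linarith
    thus ?thesis unfolding d_def stab_form_left[OF z(1) u q0] z(2)[OF q0] by simp
  qed
  define e :: "'a \<Rightarrow> real" where "e = (\<lambda>x. 1)"
  have e: "e \<in> V_0 S D" unfolding e_def by (rule constant_in_V_0)
  define c where "c = (if Gamma_p S = {} then ?A d e / (\<integral>x. 1 \<partial>lebesgue_on \<Omega>) else 0)"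
  have "?A (d + (-c) *\<^sub>R e) q = 0" if q: "q \<in> V_0 S D" for q
  proof (cases "Gamma_p S = {}")
    case False
    thus ?thesis using dP[of q] q unfolding stab_form_left[OF d e q] by (simp add: c_def pressure_space_def)
  next
    case True
    define m :: real where "m = (\<integral>x. 1 \<partial>lebesgue_on \<Omega>)"
    define k where "k = (\<integral>x. q x \<partial>lebesgue_on \<Omega>) / m"
    have "q + (-k) *\<^sub>R e \<in> pressure_space S D"
      unfolding k_def m_def e_def using True q by (rule mean_free_part)
    from dP[OF this] have "?A d q + (-k) * ?A d e = 0"
      unfolding stab_form_right[OF d q e] .
    moreover have "?A e q = k * m"
      using stab_form_const_left[OF q, folded e_def] integral_one_pos by (simp add: k_def m_def)
    moreover have "c * m = ?A d e"
      using True integral_one_pos by (simp add: c_def m_def)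
    ultimately show ?thesis
      unfolding stab_form_left[OF d e q] by (simp add: algebra_simps)
  qed
  from stab_form_injective[OF sol V_0_comb[OF d e] this]
  have "AE x in lebesgue_on \<Omega>h. (d + (-c) *\<^sub>R e) x = 0" by (simp add: null_funs_def)
  hence "AE x in lebesgue_on \<Omega>h. Div S D u x = - z x + c"
    by eventually_elim (simp add: d_def e_def)
  moreover have "Gamma_p S \<noteq> {} \<longrightarrow> c = 0" by (simp add: c_def)
  ultimately show ?thesis unfolding z_def by blast
qed

end

section \<open>The divergence of the discrete velocity\<close>

theorem lemma3p3:
  fixes S :: "'a::euclidean_space setting"
    and D :: "'i \<Rightarrow> 'a discretisation"
    and i :: 'i
    and h0 \<gamma> \<tau>d \<tau>0 :: real
    and ku kp :: nat
    and f u_h :: "'a \<Rightarrow> 'a"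
    and g u\<Gamma> p\<Gamma> p_h :: "'a \<Rightarrow> real"
  assumes "admissible_geometry S"
    and "mesh_family S h0 D"
    and "polynomial_local_space (poly_d S)" and "polynomial_local_space (poly_0 S)"
    and "largest_degree (\<lambda>j. active_cells S (D j)) (poly_d S) ku"
    and "largest_degree (\<lambda>j. active_cells S (D j)) (poly_0 S) kp"
    and "de_Rham_interpolation S D ku kp"
    and "stabilisation S D ku kp"
    and "\<gamma> > 0" and "\<tau>d > 0" and "\<tau>0 > 0"
    and "f \<in> L2_space (lebesgue_on (Omega S))" and "g \<in> L2_space (lebesgue_on (Omega S))"
    and "u\<Gamma> \<in> L2_space (surface_on (Gamma_u S))" and "p\<Gamma> \<in> L2_space (surface_on (Gamma_p S))"
    and "is_the_discrete_solution S (D i) \<gamma> \<tau>d \<tau>0 f g u\<Gamma> p\<Gamma> u_h p_h"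
  shows "(Gamma_p S \<noteq> {} \<longrightarrow>
            (AE x in lebesgue_on (Omega_h S (D i)).
               Div S (D i) u_h x = - stab_proj S (D i) \<tau>0 g x)) \<and>
         (Gamma_p S = {} \<longrightarrow>
            (\<exists>c_h::real. AE x in lebesgue_on (Omega_h S (D i)).
               Div S (D i) u_h x = - stab_proj S (D i) \<tau>0 g x + c_h)) \<and>
         ((AE x in lebesgue_on (Omega S). g x = 0) \<longrightarrow>
            (Gamma_p S \<noteq> {} \<longrightarrow>
               (AE x in lebesgue_on (Omega_h S (D i)). Div S (D i) u_h x = 0)) \<and>
            (Gamma_p S = {} \<longrightarrow>
               (\<exists>c::real. AE x in lebesgue_on (Omega_h S (D i)). Div S (D i) u_h x = c)))"
proof -
  have "\<exists>P :: 'a set. P \<noteq> {} \<and> Omega S homeomorphic P"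
    using assms(1) by (auto simp: admissible_geometry_def open_polyhedral_domain_def)
  then obtain P :: "'a set" where "P \<noteq> {}" "Omega S homeomorphic P" by blast
  hence nonempty: "Omega S \<noteq> {}" by (cases "Omega S = {}") simp_all
  have "AE x in surface_on (frontier (Omega S)). outward_unit_normal_at (Omega S) x (normal S x)"
    using assms(1) by (simp add: admissible_geometry_def)
  hence normal: "AE x in surface_on (frontier (Omega S)). norm (normal S x) = 1"
    by (rule eventually_mono) (simp add: outward_unit_normal_at_def)
  interpret cut_discretisation S "D i"
  proof
    show "open (Omega S)" "Gamma_u S \<in> sets borel" "Gamma_u S \<subseteq> frontier (Omega S)"
      "emeasure surface_measure (frontier (Omega S)) < \<infinity>"
      "normal S \<in> borel_measurable (surface_on (frontier (Omega S)))"
      using assms(1) by (auto simp: admissible_geometry_def)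
    show "conforming_mesh (background (D i)) (bg_mesh (D i))" "Omega S \<subseteq> background (D i)"
      using assms(2) by (auto simp: mesh_family_def)
    show "\<exists>k. contains_polys (active_cells S (D i)) k (poly_0 S)"
      using assms(6) unfolding largest_degree_def by blast
    show "\<And>v. v \<in> V_d S (D i) \<Longrightarrow> Div S (D i) v \<in> V_0 S (D i)"
      using assms(7) unfolding de_Rham_interpolation_def by blast
    show "bilinear_on (Omega_h S (D i)) (V_d S (D i)) (stab_d (D i))"
      "bilinear_on (Omega_h S (D i)) (V_0 S (D i)) (stab_0 (D i))"
      "\<And>c q. q \<in> V_0 S (D i) \<Longrightarrow> stab_0 (D i) (\<lambda>x. c) q = 0"
      using assms(8) by (auto simp: stabilisation_def)
  qed (use assms(3,4) nonempty normal in auto)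
  obtain c where c: "AE x in lebesgue_on (Omega_h S (D i)). Div S (D i) u_h x = - stab_proj S (D i) \<tau>0 g x + c"
    "Gamma_p S \<noteq> {} \<longrightarrow> c = 0"
    using Div_plus_stab_proj_constant[OF assms(16,13)] by blast
  have const: "AE x in lebesgue_on (Omega_h S (D i)). Div S (D i) u_h x = c"
    if "AE x in lebesgue_on (Omega S). g x = 0"
  proof -
    have "AE x in lebesgue_on (Omega_h S (D i)). stab_proj S (D i) \<tau>0 g x = 0"
      using stab_proj_null[OF assms(16,13) that] by (simp add: null_funs_def)
    with c(1) show ?thesis by eventually_elim simp
  qed
  show ?thesis
  proof (cases "Gamma_p S = {}")
    case True
    thus ?thesis using c(1) const by blast
  next
    case False
    hence "c = 0" using c(2) by blast
    thus ?thesis using False c(1) const by simp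
  qed
qed

end
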